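(* Let $\mathbf A\in L(\mathbb R^n)$ be an orthogonal operator, let $X_0\in\operatorname{conv}\mathbb R^n$ with $\operatorname{int}X_0\ne\emptyset$, and let $X(t)$, $t\ge0$, be the solution of $D_HX(t)=\mathbf AX(t)$, $X(0)=X_0$. Then for all $t\ge0$ $$V[X_0]\,e^{nt}\le V[X(t)]\le M[X_0]\,e^{nt},$$ where $$M[X_0]=\sup_{k_1,\dots,k_{n-1}\ge0}V[\mathbf A^{k_1}X_0,\mathbf A^{k_2}X_0,\dots,\mathbf A^{k_{n-1}}X_0,X_0],$$ the supremum being over all $(n-1)$-tuples of nonnegative integers.
   Context: $\operatorname{conv}\mathbb R^n$ is the space of nonempty convex compact subsets of $\mathbb R^n$ with the Hausdorff metric $d_H$. $\mathbf AX=\{\mathbf Ax:x\in X\}$; sums of sets are Minkowski sums. $V[X]$ is the volume and $V[X_1,\dots,X_n]$ the mixed volume, normalized so that $V[X,\dots,X]=V[X]$. Hukuhara derivative: for $X,Y\in\operatorname{conv}\mathbb R^n$, the Hukuhara difference $X\ominus Y$ is the set $Z\in\operatorname{conv}\mathbb R^n$ with $X=Y+Z$, if it exists. $D_HX(t)$ is the element of $\operatorname{conv}\mathbb R^n$ that is the common $d_H$-limit, as $h\to0^+$, of $h^{-1}(X(t+h)\ominus X(t))$ and $h^{-1}(X(t)\ominus X(t-h))$ (only the first at $t=0$). The Cauchy problem $D_HX=\mathbf AX$, $X(0)=X_0$, has a unique solution on $[0,\infty)$, equivalently $X(t)=X_0+\int_0^t\mathbf AX(s)\,ds$ (set-valued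 integral). *)

theory Defs
  imports "HOL-Analysis.Analysis"
begin

text \<open>Minkowski sums of sets are the operation \<open>+\<close> (and \<open>\<Sum>\<close>) of
  \<^theory>\<open>HOL-Library.Set_Algebras\<close>.\<close>

definition conv_bodies :: "'a::euclidean_space set set" where
  "conv_bodies = {X. X \<noteq> {} \<and> convex X \<and> compact X}"

definition hausdorff_dist :: "'a::metric_space set \<Rightarrow> 'a set \<Rightarrow> real" where
  "hausdorff_dist X Y = max (SUP x\<in>X. infdist x Y) (SUP y\<in>Y. infdist y X)"

definition is_hukuhara_diff :: "'a::euclidean_space set \<Rightarrow> 'a set \<Rightarrow> 'a set \<Rightarrow> bool" where
  "is_hukuhara_diff X Y Z \<longleftrightarrow> Z \<in> conv_bodies \<and> X = Y + Z"

text \<open>For compact convex nonempty \<open>Y\<close> the difference is unique by the cancellation law for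
  Minkowski addition; where it does not exist the value below is unspecified, so existence is
  always required separately.\<close>

definition hukuhara_diff :: "'a::euclidean_space set \<Rightarrow> 'a set \<Rightarrow> 'a set" where
  "hukuhara_diff X Y = (THE Z. is_hukuhara_diff X Y Z)"

definition has_right_hukuhara_derivative ::
    "(real \<Rightarrow> 'a::euclidean_space set) \<Rightarrow> 'a set \<Rightarrow> real \<Rightarrow> bool" where
  "has_right_hukuhara_derivative X D t \<longleftrightarrow>
     (\<forall>\<^sub>F h in at_right 0. \<exists>Z. is_hukuhara_diff (X (t + h)) (X t) Z) \<and>
     ((\<lambda>h. hausdorff_dist ((*\<^sub>R) (1 / h) ` hukuhara_diff (X (t + h)) (X t)) D)
        \<longlongrightarrow> 0) (at_right 0)"

definition has_left_hukuhara_derivative ::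
    "(real \<Rightarrow> 'a::euclidean_space set) \<Rightarrow> 'a set \<Rightarrow> real \<Rightarrow> bool" where
  "has_left_hukuhara_derivative X D t \<longleftrightarrow>
     (\<forall>\<^sub>F h in at_right 0. \<exists>Z. is_hukuhara_diff (X t) (X (t - h)) Z) \<and>
     ((\<lambda>h. hausdorff_dist ((*\<^sub>R) (1 / h) ` hukuhara_diff (X t) (X (t - h))) D)
        \<longlongrightarrow> 0) (at_right 0)"

text \<open>For set-valued functions on \<open>[0, \<infinity>)\<close>: one-sided at \<open>t = 0\<close>.\<close>

definition has_hukuhara_derivative ::
    "(real \<Rightarrow> 'a::euclidean_space set) \<Rightarrow> 'a set \<Rightarrow> real \<Rightarrow> bool" where
  "has_hukuhara_derivative X D t \<longleftrightarrow>
     D \<in> conv_bodies \<and> has_right_hukuhara_derivative X D t \<and>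
     (t > 0 \<longrightarrow> has_left_hukuhara_derivative X D t)"

definition hukuhara_solution ::
    "('a::euclidean_space \<Rightarrow> 'a) \<Rightarrow> 'a set \<Rightarrow> (real \<Rightarrow> 'a set) \<Rightarrow> bool" where
  "hukuhara_solution A X0 X \<longleftrightarrow>
     (\<forall>t\<ge>0. X t \<in> conv_bodies) \<and> X 0 = X0 \<and>
     (\<forall>t\<ge>0. has_hukuhara_derivative X (A ` X t) t)"

abbreviation vol :: "'a::euclidean_space set \<Rightarrow> real" where
  "vol X \<equiv> measure lebesgue X"

text \<open>The coefficients \<open>c (i\<^sub>1, \<dots>, i\<^sub>n) = V[K\<^bsub>i\<^sub>1\<^esub>, \<dots>, K\<^bsub>i\<^sub>n\<^esub>]\<close> in Minkowski's expansion
  \<open>V[\<Sum>\<^sub>j x\<^sub>j K\<^sub>j] = \<Sum>\<^bsub>i\<^sub>1, \<dots>, i\<^sub>n\<^esub> c (i\<^sub>1, \<dots>, i\<^sub>n) x\<^bsub>i\<^sub>1\<^esub> \<cdots> x\<^bsub>i\<^sub>n\<^esub>\<close>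
  for \<open>x\<^sub>j \<ge> 0\<close>. The sum is over all ordered \<open>n\<close>-tuples of indices, so a symmetric \<open>c\<close> is
  unique and the normalization is \<open>V[K, \<dots>, K] = V[K]\<close>. Lists are meant to have length
  \<open>n = CARD('n)\<close>, indexed from \<open>0\<close>.\<close>

definition is_mixed_volume_coeffs ::
    "(real ^ 'n) set list \<Rightarrow> ((nat \<Rightarrow> nat) \<Rightarrow> real) \<Rightarrow> bool" where
  "is_mixed_volume_coeffs Ks c \<longleftrightarrow>
     (let n = CARD('n); I = {..<n} \<rightarrow>\<^sub>E {..<n} in
       (\<forall>i\<in>I. \<forall>p. p permutes {..<n} \<longrightarrow> c (i \<circ> p) = c i) \<and>
       (\<forall>x. (\<forall>j<n. 0 \<le> x j) \<longrightarrow>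
          vol (\<Sum>j<n. (*\<^sub>R) (x j) ` (Ks ! j)) = (\<Sum>i\<in>I. c i * (\<Prod>l<n. x (i l)))))"

definition mixed_volume :: "(real ^ 'n) set list \<Rightarrow> real" where
  "mixed_volume Ks =
     (THE v. \<exists>c. is_mixed_volume_coeffs Ks c \<and> v = c (restrict id {..<CARD('n)}))"

definition M_bound :: "(real ^ 'n \<Rightarrow> real ^ 'n) \<Rightarrow> (real ^ 'n) set \<Rightarrow> real" where
  "M_bound A X0 =
     (SUP ks \<in> {ks :: nat list. length ks = CARD('n) - 1}.
        mixed_volume (map (\<lambda>k. (A ^^ k) ` X0) ks @ [X0]))"

end

theory Submission
  imports Defs
begin

text \<open>The solution is \<open>X t = (\<Sum>j. t ^ j / j! A ^ j X0)\<close>: the support functions satisfy a scalar linear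
  equation whose Taylor remainder tends to zero, and bodies with close support functions have close
  volumes as soon as one of them contains a fixed ball. The lower bound is Brunn-Minkowski for the partial
  sums, whose terms have volumes \<open>(t ^ j / j!) ^ n V[X0]\<close>. For the upper bound one expands the volume of
  a partial sum into mixed volumes \<open>V[A ^ i\<^sub>1 X0, \<dots>, A ^ i\<^sub>n X0]\<close>; factoring out the smallest power of
  the volume preserving \<open>A\<close> leaves a mixed volume with one entry \<open>X0\<close>, which is at most \<open>M[X0]\<close>.

  Minkowski's expansion is obtained for polytopes \<open>P\<^sub>j = conv V\<^sub>j\<close> from the functions
  \<open>f\<^sub>j y = ln (\<Sum>v\<in>V\<^sub>j. exp (v \<bullet> y))\<close>: the gradient of \<open>\<Sum>j. x\<^sub>j f\<^sub>j\<close> maps the space injectively onto the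
  interior of \<open>\<Sum>j. x\<^sub>j P\<^sub>j\<close>, so the volume is the integral of \<open>det (\<Sum>j. x\<^sub>j Hess f\<^sub>j)\<close>, a homogeneous
  polynomial in \<open>x\<close>. Writing the coefficients by polarization makes the identity stable under limits.
  Brunn-Minkowski is proved by the Hadwiger-Ohmann argument.\<close>

section \<open>Convex bodies and support functions\<close>

text \<open>\<open>mixed_volume\<close> is a definite description, so its value at a list of bodies
  is known only once Minkowski's expansion holds for them and its symmetric coefficients are unique.
  Polarization serves both purposes, since it expresses the coefficients by volumes of sub-sums
  alone. Support functions turn Minkowski sums into sums of reals, so the set-valued equation splits
  into one scalar equation for each direction \<open>u\<close>. That equation is not closed in
  \<open>u\<close>, as \<open>A\<close> moves the direction to \<open>adjoint A u\<close>. The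
  support functions of A^k X(s) at a fixed \<open>u\<close>, k = 0, 1, ..., do form a closed tower
  in which each is the derivative of its predecessor; \<open>A\<close> is an isometry, so one
  constant bounds them all on [0, t]. The estimate therefore holds for any solution, as each is
  approximated by the partial sums. The factor e^(nt) is the limit of the n-th power of the sum of
  t^j / j!. In the lower bound this sum arises because n-th roots of volumes are superadditive, in
  the upper bound because it is the sum of the weights in the expansion.\<close>

lemma compact_set_plus:
  fixes S T :: "'a::real_normed_vector set"
  assumes "compact S" "compact T"
  shows "compact (S + T)"
proof -
  have "S + T = {x + y | x y. x \<in> S \<and> y \<in> T}"
    by (auto simp: set_plus_def)
  then show ?thesis
    using compact_sums[OF assms] by (simp only:)
qed

lemma conv_bodies_zero: "0 \<in> conv_bodies"
  by (simp add: conv_bodies_def)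

lemma conv_bodies_plus: "K \<in> conv_bodies \<Longrightarrow> L \<in> conv_bodies \<Longrightarrow> K + L \<in> conv_bodies"
  by (auto simp: conv_bodies_def compact_set_plus convex_set_plus)

lemma conv_bodies_sum: "(\<And>i. i \<in> I \<Longrightarrow> K i \<in> conv_bodies) \<Longrightarrow> (\<Sum>i\<in>I. K i) \<in> conv_bodies"
  by (induction I rule: infinite_finite_induct) (simp_all add: conv_bodies_zero conv_bodies_plus del: set_zero)

lemma conv_bodies_linear_image:
  assumes "linear f" "K \<in> conv_bodies"
  shows "f ` K \<in> conv_bodies"
  using assms
  by (auto simp: conv_bodies_def convex_linear_image compact_continuous_image linear_continuous_on linear_linear)

lemma conv_bodies_scaleR: "K \<in> conv_bodies \<Longrightarrow> (*\<^sub>R) c ` K \<in> conv_bodies"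
  by (intro conv_bodies_linear_image linear_scale_self)

lemma conv_bodies_compact: "K \<in> conv_bodies \<Longrightarrow> compact K"
  by (simp add: conv_bodies_def)

lemma linear_image_set_plus:
  assumes "linear f"
  shows "f ` (K + L) = f ` K + f ` L"
  unfolding set_plus_image image_image
  by (auto simp: linear_add[OF assms] image_iff) blast+

lemma linear_image_set_sum:
  assumes "linear f"
  shows "f ` (\<Sum>i\<in>I. K i) = (\<Sum>i\<in>I. f ` K i)"
  by (induction I rule: infinite_finite_induct)
    (simp_all add: linear_image_set_plus[OF assms] linear_0[OF assms])

lemma vol_translation_scaleR:
  fixes K :: "'a::euclidean_space set"
  shows "vol ((+) z ` (*\<^sub>R) c ` K) = \<bar>c\<bar> ^ DIM('a) * vol K"
proof -
  have "(+) z ` (*\<^sub>R) c ` K = (\<lambda>x. c *\<^sub>R x + z) ` K"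
    by (auto simp: image_image add.commute)
  then show ?thesis
    using measure_lebesgue_affine[of c z K] by simp
qed

lemma vol_scaleR:
  fixes K :: "'a::euclidean_space set"
  shows "vol ((*\<^sub>R) c ` K) = \<bar>c\<bar> ^ DIM('a) * vol K"
  using vol_translation_scaleR[of 0 c K] by simp

lemma vol_mono:
  fixes K L :: "'a::euclidean_space set"
  shows "K \<subseteq> L \<Longrightarrow> compact K \<Longrightarrow> compact L \<Longrightarrow> vol K \<le> vol L"
  by (intro measure_mono_fmeasurable lmeasurable_compact fmeasurableD)

lemma vol_pos:
  fixes K :: "'a::euclidean_space set"
  assumes "K \<in> conv_bodies" "interior K \<noteq> {}"
  shows "0 < vol K"
  using assms negligible_convex_interior[of K] lmeasurable_compact[of K]
  by (auto simp: conv_bodies_def zero_less_measure_iff negligible_iff_measure)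

lemma vol_pos_imp_interior:
  fixes K :: "'a::euclidean_space set"
  assumes "convex K" "0 < vol K"
  shows "interior K \<noteq> {}"
  using assms negligible_convex_interior[of K] negligible_imp_measure0[of K] by auto

section \<open>Support functions: calculus, inclusion and comparison of volumes\<close>

definition support_fun :: "'a::euclidean_space set \<Rightarrow> 'a \<Rightarrow> real" where
  "support_fun K u = (SUP x\<in>K. x \<bullet> u)"

lemma support_fun_attained:
  assumes "K \<in> conv_bodies"
  shows "\<exists>x\<in>K. support_fun K u = x \<bullet> u \<and> (\<forall>y\<in>K. y \<bullet> u \<le> x \<bullet> u)"
proof -
  have "\<exists>x\<in>K. \<forall>y\<in>K. y \<bullet> u \<le> x \<bullet> u"
    using assms by (intro continuous_attains_sup continuous_intros) (auto simp: conv_bodies_def)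
  then obtain x where x: "x \<in> K" "\<And>y. y \<in> K \<Longrightarrow> y \<bullet> u \<le> x \<bullet> u" by blast
  then have "support_fun K u = x \<bullet> u"
    unfolding support_fun_def by (intro cSup_eq_maximum) auto
  with x show ?thesis by blast
qed

lemma support_fun_upper:
  assumes "K \<in> conv_bodies" "x \<in> K"
  shows "x \<bullet> u \<le> support_fun K u"
  using support_fun_attained[OF assms(1)] assms(2) by metis

lemma support_fun_eqI:
  assumes "x \<in> K" "x \<bullet> u = s" "\<And>y. y \<in> K \<Longrightarrow> y \<bullet> u \<le> s"
  shows "support_fun K u = s"
  unfolding support_fun_def using assms by (intro cSup_eq_maximum) auto

lemma support_fun_zero [simp]: "support_fun 0 u = 0"
  by (rule support_fun_eqI[of 0]) auto

lemma support_fun_plus: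
  assumes "K \<in> conv_bodies" "L \<in> conv_bodies"
  shows "support_fun (K + L) u = support_fun K u + support_fun L u"
proof -
  obtain x y where x: "x \<in> K" "support_fun K u = x \<bullet> u" "\<And>z. z \<in> K \<Longrightarrow> z \<bullet> u \<le> x \<bullet> u"
    and y: "y \<in> L" "support_fun L u = y \<bullet> u" "\<And>z. z \<in> L \<Longrightarrow> z \<bullet> u \<le> y \<bullet> u"
    using support_fun_attained[OF assms(1)] support_fun_attained[OF assms(2)] by metis
  show ?thesis
  proof (rule support_fun_eqI[of "x + y"])
    show "x + y \<in> K + L" using x y by auto
    show "(x + y) \<bullet> u = support_fun K u + support_fun L u"
      using x y by (simp add: inner_add_left)
    show "z \<bullet> u \<le> support_fun K u + support_fun L u" if "z \<in> K + L" for z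
      using that x(2,3) y(2,3) by (auto simp: set_plus_def inner_add_left intro!: add_mono)
  qed
qed

lemma support_fun_sum:
  "(\<And>i. i \<in> I \<Longrightarrow> K i \<in> conv_bodies) \<Longrightarrow>
    support_fun (\<Sum>i\<in>I. K i) u = (\<Sum>i\<in>I. support_fun (K i) u)"
  by (induction I rule: infinite_finite_induct)
    (simp_all add: support_fun_plus conv_bodies_sum del: set_zero)

lemma support_fun_linear_image:
  assumes "linear f" "K \<in> conv_bodies"
  shows "support_fun (f ` K) u = support_fun K (adjoint f u)"
  using adjoint_works[OF assms(1)] by (simp add: support_fun_def image_image)

lemma support_fun_scaleR:
  assumes "K \<in> conv_bodies" "0 \<le> c"
  shows "support_fun ((*\<^sub>R) c ` K) u = c * support_fun K u"
proof -
  obtain x where x: "x \<in> K" "support_fun K u = x \<bullet> u" "\<And>z. z \<in> K \<Longrightarrow> z \<bullet> u \<le> x \<bullet> u"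
    using support_fun_attained[OF assms(1)] by metis
  show ?thesis
    by (rule support_fun_eqI[of "c *\<^sub>R x"]) (use x assms(2) in \<open>auto intro!: mult_left_mono\<close>)
qed

text \<open>A point of \<open>K\<close> outside \<open>L\<close> could be strictly separated from
  \<open>L\<close>, and the normal of the hyperplane would violate the inequality.\<close>

lemma subset_if_support_fun_le:
  assumes "K \<in> conv_bodies" "L \<in> conv_bodies" "\<And>u. support_fun K u \<le> support_fun L u"
  shows "K \<subseteq> L"
proof
  fix x assume x: "x \<in> K"
  show "x \<in> L"
  proof (rule ccontr)
    assume "x \<notin> L"
    then obtain a b where ab: "a \<bullet> x < b" "\<And>y. y \<in> L \<Longrightarrow> b < a \<bullet> y"
      using separating_hyperplane_closed_point[of L x] assms(2)
      by (auto simp: conv_bodies_def compact_imp_closed)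
    \<comment> \<open>The separation puts \<open>x\<close> on the low side of \<open>a\<close>, so
      the violating direction is \<open>- a\<close>.\<close>
    obtain y where "y \<in> L" "support_fun L (- a) = y \<bullet> (- a)"
      using support_fun_attained[OF assms(2)] by metis
    then have "support_fun L (- a) < support_fun K (- a)"
      using ab(1) ab(2)[of y] support_fun_upper[OF assms(1) x, of "- a"] by (simp add: inner_commute)
    with assms(3)[of "- a"] show False by simp
  qed
qed

lemma support_fun_inject:
  assumes "K \<in> conv_bodies" "L \<in> conv_bodies" "\<And>u. support_fun K u = support_fun L u"
  shows "K = L"
  using assms by (intro equalityI subset_if_support_fun_le) auto

lemma support_fun_ge_cball:
  assumes "L \<in> conv_bodies" "cball p r \<subseteq> L" "0 \<le> r"
  shows "p \<bullet> u + r * norm u \<le> support_fun L u"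
proof -
  \<comment> \<open>\<open>sgn u\<close> is \<open>0\<close> for \<open>u = 0\<close>, so that case
    needs no separate treatment.\<close>
  have "p + r *\<^sub>R sgn u \<in> cball p r"
    using assms(3) by (simp add: norm_sgn dist_norm)
  then have "(p + r *\<^sub>R sgn u) \<bullet> u \<le> support_fun L u"
    using assms by (intro support_fun_upper) auto
  moreover have "sgn u \<bullet> u = norm u"
    by (cases "u = 0") (simp_all add: sgn_div_norm dot_square_norm power2_eq_square)
  ultimately show ?thesis
    by (simp add: inner_add_left)
qed

text \<open>The ball turns an additive error into a multiplicative one: \<open>e * norm u\<close> is
  at most \<open>e / r\<close> times \<open>support_fun L u - p \<bullet> u\<close>, so
  \<open>K\<close> lies in the image of \<open>L\<close> under the homothety with centre
  \<open>p\<close> and ratio \<open>1 + e / r\<close>. The ball is given by support functions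
  because this form survives the subtraction of an error.\<close>

lemma vol_le_if_support_fun_le:
  fixes K L :: "'a::euclidean_space set"
  assumes K: "K \<in> conv_bodies" and L: "L \<in> conv_bodies"
    and ball: "\<And>u. p \<bullet> u + r * norm u \<le> support_fun L u" and "0 < r" "0 \<le> e"
    and le: "\<And>u. support_fun K u \<le> support_fun L u + e * norm u"
  shows "vol K \<le> (1 + e / r) ^ DIM('a) * vol L"
proof -
  let ?T = "(+) (- (e / r) *\<^sub>R p) ` (*\<^sub>R) (1 + e / r) ` L"
  have T: "?T = {- (e / r) *\<^sub>R p} + (*\<^sub>R) (1 + e / r) ` L"
    by (auto simp: set_plus_def)
  have sing: "{- (e / r) *\<^sub>R p} \<in> conv_bodies"
    by (simp add: conv_bodies_def)
  have supp_sing: "support_fun {- (e / r) *\<^sub>R p} u = - (e / r) * (p \<bullet> u)" for u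
    by (rule support_fun_eqI) auto
  have body: "?T \<in> conv_bodies"
    unfolding T using sing L by (intro conv_bodies_plus conv_bodies_scaleR)
  have "support_fun K u \<le> support_fun ?T u" for u
  proof -
    have "support_fun ?T u = - (e / r) * (p \<bullet> u) + (1 + e / r) * support_fun L u"
      unfolding T support_fun_plus[OF sing conv_bodies_scaleR[OF L]] supp_sing
      using assms(4,5) by (subst support_fun_scaleR[OF L]) simp_all
    moreover have "(e / r) * (p \<bullet> u + r * norm u) \<le> (e / r) * support_fun L u"
      using assms by (intro mult_left_mono) auto
    then have "e * norm u \<le> (e / r) * support_fun L u - (e / r) * (p \<bullet> u)"
      using \<open>0 < r\<close> by (simp add: distrib_left)
    ultimately show ?thesis
      using le[of u] by (simp add: distrib_right)
  qed
  then have "K \<subseteq> ?T"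
    by (rule subset_if_support_fun_le[OF K body])
  then have "vol K \<le> vol ?T"
    using K body by (intro vol_mono conv_bodies_compact)
  also have "\<dots> = (1 + e / r) ^ DIM('a) * vol L"
    using assms by (subst vol_translation_scaleR) simp
  finally show ?thesis .
qed

section \<open>Well-ordered index types\<close>

text \<open>HOL-Analysis proves change of variables in \<open>real ^ 'n\<close> only for index types of class \<open>wellorder\<close>;
  results for an arbitrary finite \<open>'n\<close> are transferred from this copy of it.\<close>

typedef 'a wo_copy = "UNIV :: 'a set" morphisms of_wo to_wo ..

lemma bij_of_wo: "bij of_wo"
  by (metis bij_def injI of_wo_inject surj_def to_wo_inverse UNIV_I)

instance wo_copy :: (finite) finite
proof
  show "finite (UNIV :: 'a wo_copy set)"
    using bij_of_wo[where 'a='a] by (metis bij_def finite finite_imageD inj_on_subset subset_UNIV)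
qed

text \<open>The order of \<open>nat\<close> pulled back along any injection is a well-order.\<close>

definition wo_rank :: "'a::finite wo_copy \<Rightarrow> nat" where
  "wo_rank = (SOME f. inj f)"

lemma inj_wo_rank: "inj (wo_rank :: 'a::finite wo_copy \<Rightarrow> nat)"
proof -
  have "\<exists>f :: 'a wo_copy \<Rightarrow> nat. inj f"
    using finite_imp_inj_to_nat_seg[of "UNIV :: 'a wo_copy set"] by auto
  then show ?thesis
    unfolding wo_rank_def by (rule someI_ex)
qed

instantiation wo_copy :: (finite) wellorder
begin

definition less_eq_wo_copy :: "'a wo_copy \<Rightarrow> 'a wo_copy \<Rightarrow> bool" where
  "less_eq_wo_copy x y \<longleftrightarrow> wo_rank x \<le> wo_rank y"

definition less_wo_copy :: "'a wo_copy \<Rightarrow> 'a wo_copy \<Rightarrow> bool" where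
  "less_wo_copy x y \<longleftrightarrow> wo_rank x < wo_rank y"

instance
proof
  fix x y z :: "'a wo_copy" and P
  show "x < y \<longleftrightarrow> x \<le> y \<and> \<not> y \<le> x"
    unfolding less_eq_wo_copy_def less_wo_copy_def by linarith
  show "x \<le> x"
    unfolding less_eq_wo_copy_def less_wo_copy_def by linarith
  show "x \<le> y \<or> y \<le> x"
    unfolding less_eq_wo_copy_def less_wo_copy_def by linarith
  show "x \<le> y \<Longrightarrow> y \<le> z \<Longrightarrow> x \<le> z"
    unfolding less_eq_wo_copy_def less_wo_copy_def by linarith
  show "x \<le> y \<Longrightarrow> y \<le> x \<Longrightarrow> x = y"
    unfolding less_eq_wo_copy_def using injD[OF inj_wo_rank, of x y] by linarith
  show "P x" if step: "\<And>x. (\<And>y. y < x \<Longrightarrow> P y) \<Longrightarrow> P x"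
  proof (induction x rule: measure_induct_rule[of wo_rank])
    case (less x)
    show ?case
      by (rule step) (rule less.IH, simp only: less_wo_copy_def)
  qed
qed

end

lemma CARD_wo_copy: "CARD('a wo_copy) = CARD('a)"
  using bij_of_wo by (rule bij_betw_same_card)

definition reindex :: "real ^ 'n \<Rightarrow> real ^ 'n wo_copy" where
  "reindex x = (\<chi> i. x $ of_wo i)"

lemma linear_reindex: "linear reindex"
  by (rule linearI) (simp_all add: reindex_def vec_eq_iff)

lemma reindex_inverse: "reindex (\<chi> i. y $ to_wo i) = y"
  by (simp add: reindex_def vec_eq_iff of_wo_inverse)

lemma bij_reindex: "bij reindex"
proof (rule bijI')
  show "reindex x = reindex y \<longleftrightarrow> x = y" for x y :: "real ^ 'a"
    unfolding reindex_def vec_eq_iff by (metis to_wo_inverse UNIV_I vec_lambda_beta)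
  show "\<exists>x. y = reindex x" for y :: "real ^ 'a wo_copy"
    by (metis reindex_inverse)
qed

lemma inner_reindex: "reindex x \<bullet> reindex y = x \<bullet> y"
  unfolding inner_vec_def reindex_def
  using sum.reindex_bij_betw[OF bij_of_wo, of "\<lambda>i. x $ i * y $ i"] by simp

lemma prod_inner_Basis_cart: "(\<Prod>b\<in>Basis. x \<bullet> b) = (\<Prod>i\<in>UNIV. x $ i)" for x :: "real ^ 'n"
proof -
  have "bij_betw (\<lambda>i::'n. axis i (1::real)) UNIV Basis"
    by (auto simp: bij_betw_def inj_on_def axis_eq_axis Basis_vec_def)
  from prod.reindex_bij_betw[OF this, of "\<lambda>b. x \<bullet> b"] show ?thesis
    by (simp only: inner_axis inner_real_def mult_1_right)
qed

lemma continuous_on_reindex: "continuous_on S reindex"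
  by (simp add: linear_continuous_on linear_linear linear_reindex)

text \<open>\<open>lborel\<close> is determined by its values on boxes, and renaming coordinates
  turns boxes into boxes with the same product of side lengths.\<close>

lemma lborel_reindex: "lborel = distr lborel borel (reindex :: real ^ 'n \<Rightarrow> _)"
proof (rule lborel_eqI)
  fix l u :: "real ^ 'n wo_copy"
  assume lu: "\<And>b. b \<in> Basis \<Longrightarrow> l \<bullet> b \<le> u \<bullet> b"
  let ?l = "\<chi> i. l $ to_wo i" and ?u = "\<chi> i. u $ to_wo i"
  have le: "l $ i \<le> u $ i" for i
    using lu[of "axis i 1"] by (simp add: inner_axis axis_in_Basis_iff)
  have "reindex -` box l u = box ?l ?u"
  proof -
    have "(\<forall>i. P (of_wo i) i) \<longleftrightarrow> (\<forall>i. P i (to_wo i))" for P :: "'n \<Rightarrow> 'n wo_copy \<Rightarrow> bool"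
      by (metis of_wo_inverse to_wo_inverse UNIV_I)
    from this[of "\<lambda>i j. l $ j < x $ i \<and> x $ i < u $ j" for x] show ?thesis
      by (simp add: set_eq_iff mem_box_cart reindex_def)
  qed
  then have "emeasure (distr lborel borel reindex) (box l u) = emeasure lborel (box ?l ?u)"
    by (simp add: emeasure_distr borel_measurable_continuous_onI continuous_on_reindex)
  also have "\<dots> = ennreal (\<Prod>b\<in>Basis. (?u - ?l) \<bullet> b)"
    using le by (intro emeasure_lborel_box) (auto simp: Basis_vec_def inner_axis)
  also have "(\<Prod>b\<in>Basis. (?u - ?l) \<bullet> b) = (\<Prod>i\<in>UNIV. (u - l) $ to_wo i)"
    unfolding prod_inner_Basis_cart by simp
  also have "\<dots> = (\<Prod>i\<in>UNIV. (u - l) $ i)"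
    by (rule prod.reindex_bij_witness[of _ of_wo to_wo]) (simp_all add: of_wo_inverse to_wo_inverse)
  also have "\<dots> = (\<Prod>b\<in>Basis. (u - l) \<bullet> b)"
    unfolding prod_inner_Basis_cart ..
  finally show "emeasure (distr lborel borel reindex) (box l u) = (\<Prod>b\<in>Basis. (u - l) \<bullet> b)" .
qed simp

lemma vol_reindex:
  fixes S :: "(real ^ 'n) set"
  assumes "compact S"
  shows "vol (reindex ` S) = vol S"
proof -
  have S: "S \<in> sets borel" "reindex ` S \<in> sets borel"
    using assms by (auto intro!: borel_compact compact_continuous_image continuous_on_reindex)
  have "reindex -` reindex ` S = S"
    by (rule inj_vimage_image_eq[OF bij_is_inj[OF bij_reindex]])
  then have "measure lborel (reindex ` S) = measure lborel S"
    using S measure_distr[of "reindex :: real ^ 'n \<Rightarrow> _" lborel borel "reindex ` S"]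
    unfolding lborel_reindex[symmetric]
    by (simp add: borel_measurable_continuous_onI continuous_on_reindex)
  then show ?thesis
    using S by (simp add: measure_completion)
qed

text \<open>Conjugation with \<open>reindex\<close>, an isometry that preserves volume, carries
  \<open>A\<close> to an orthogonal map over the well-ordered copy.\<close>

lemma vol_orthogonal_image:
  fixes A :: "real ^ 'n \<Rightarrow> real ^ 'n"
  assumes A: "orthogonal_transformation A" and S: "compact S"
  shows "vol (A ` S) = vol S"
proof -
  define inv_reindex :: "real ^ 'n wo_copy \<Rightarrow> real ^ 'n" where "inv_reindex y = (\<chi> i. y $ to_wo i)" for y
  have inv: "inv_reindex (reindex x) = x" "reindex (inv_reindex y) = y" for x y
    by (simp_all add: inv_reindex_def reindex_def vec_eq_iff of_wo_inverse to_wo_inverse)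
  have linA: "linear A"
    using A by (rule orthogonal_transformation_linear)
  have "linear inv_reindex"
    by (rule linearI) (simp_all add: inv_reindex_def vec_eq_iff)
  from linear_compose[OF linear_compose[OF this linA] linear_reindex]
  have lin: "linear (\<lambda>x. reindex (A (inv_reindex x)))"
    by (simp only: o_def)
  have "A x \<bullet> A y = x \<bullet> y" for x y
    using A by (simp add: orthogonal_transformation_def)
  then have "reindex (A (inv_reindex x)) \<bullet> reindex (A (inv_reindex y)) = x \<bullet> y" for x y
    using inner_reindex[of "inv_reindex x" "inv_reindex y"] by (simp only: inner_reindex inv)
  with lin have "orthogonal_transformation (\<lambda>x. reindex (A (inv_reindex x)))"
    unfolding orthogonal_transformation_def by blast
  then have "vol ((\<lambda>x. reindex (A (inv_reindex x))) ` reindex ` S) = vol (reindex ` S)"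
    by (rule measure_orthogonal_image)
      (rule lmeasurable_compact[OF compact_continuous_image[OF continuous_on_reindex S]])
  moreover have "(\<lambda>x. reindex (A (inv_reindex x))) ` reindex ` S = reindex ` A ` S"
    by (simp add: image_image inv)
  moreover have "compact (A ` S)"
    using linA S by (simp add: compact_continuous_image linear_continuous_on linear_linear)
  ultimately show ?thesis
    using S by (simp add: vol_reindex)
qed

section \<open>Polarization\<close>

text \<open>Inclusion-exclusion over subsets of the \<open>n\<close> slots. If \<open>F J\<close> is
  the value of an \<open>n\<close>-homogeneous polynomial at the indicator vector of
  \<open>J\<close>, this is the coefficient of the product of all \<open>n\<close> variables divided
  by \<open>n!\<close>, that is, the symmetric coefficient.\<close>

definition polarization :: "nat \<Rightarrow> (nat set \<Rightarrow> real) \<Rightarrow> real" where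
  "polarization n F = (\<Sum>J\<in>Pow {..<n}. (-1) ^ (n - card J) * F J) / fact n"

lemma polarization_cong:
  "(\<And>J. J \<subseteq> {..<n} \<Longrightarrow> F J = G J) \<Longrightarrow> polarization n F = polarization n G"
  by (simp add: polarization_def)

text \<open>Among the sets between \<open>R\<close> and \<open>N\<close>, even and odd cardinalities
  balance unless \<open>R = N\<close>.\<close>

lemma alternating_sum_supersets:
  assumes "finite N" "R \<subseteq> N"
  shows "(\<Sum>J | J \<subseteq> N \<and> R \<subseteq> J. (-1) ^ (card N - card J)) = (if R = N then 1 else 0 :: real)"
proof (cases "R = N")
  case True
  then have "{J. J \<subseteq> N \<and> R \<subseteq> J} = {N}" by auto
  with True show ?thesis by simp
next
  case False
  have "{J \<in> {J. J \<subseteq> N \<and> R \<subseteq> J}. Q (card J)} = {J. J \<subseteq> N \<and> R \<subseteq> J \<and> Q (card J)}" for Q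
    by auto
  then have "(\<Sum>J | J \<subseteq> N \<and> R \<subseteq> J. (-1) ^ card J) = (0::real)"
    using card_subsupersets_even_odd[of N R] False assms
    by (intro sum_alternating_cancels) auto
  moreover have "(\<Sum>J | J \<subseteq> N \<and> R \<subseteq> J. (-1) ^ (card N - card J)) =
      (\<Sum>J | J \<subseteq> N \<and> R \<subseteq> J. (-1) ^ card N * (-1) ^ card J :: real)"
    using assms by (intro sum.cong) (auto simp: minus_one_power_iff dest: card_mono[of N])
  ultimately show ?thesis
    using False by (simp flip: sum_distrib_left)
qed

text \<open>A tuple \<open>f\<close> contributes to every \<open>J\<close> that contains its image,
  so the cancellation leaves only tuples with image \<open>{..<n}\<close>, and these are the
  permutations.\<close>

lemma polarization_sum_PiE:
  "polarization n (\<lambda>J. \<Sum>f\<in>{..<n} \<rightarrow>\<^sub>E J. d f) =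
    (\<Sum>p | p permutes {..<n}. d (restrict p {..<n})) / fact n"
proof -
  let ?N = "{..<n}"
  have fin: "finite (?N \<rightarrow>\<^sub>E ?N)"
    by (simp add: finite_PiE)
  have "(\<Sum>J\<in>Pow ?N. (-1) ^ (n - card J) * (\<Sum>f\<in>?N \<rightarrow>\<^sub>E J. d f)) =
      (\<Sum>J\<in>Pow ?N. \<Sum>f\<in>?N \<rightarrow>\<^sub>E ?N. if f ` ?N \<subseteq> J then (-1) ^ (n - card J) * d f else 0)"
  proof (rule sum.cong[OF refl])
    fix J assume "J \<in> Pow ?N"
    then have "?N \<rightarrow>\<^sub>E J = {f \<in> ?N \<rightarrow>\<^sub>E ?N. f ` ?N \<subseteq> J}"
      unfolding PiE_iff set_eq_iff mem_Collect_eq by blast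
    then show "(-1) ^ (n - card J) * (\<Sum>f\<in>?N \<rightarrow>\<^sub>E J. d f) =
        (\<Sum>f\<in>?N \<rightarrow>\<^sub>E ?N. if f ` ?N \<subseteq> J then (-1) ^ (n - card J) * d f else 0)"
      by (simp add: sum_distrib_left sum.inter_filter[OF fin] if_distrib cong: if_cong)
  qed
  also have "\<dots> = (\<Sum>f\<in>?N \<rightarrow>\<^sub>E ?N. \<Sum>J\<in>Pow ?N. if f ` ?N \<subseteq> J then (-1) ^ (n - card J) * d f else 0)"
    by (rule sum.swap)
  also have "\<dots> = (\<Sum>f\<in>?N \<rightarrow>\<^sub>E ?N. if f ` ?N = ?N then d f else 0)"
  proof (rule sum.cong[OF refl])
    fix f assume f: "f \<in> ?N \<rightarrow>\<^sub>E ?N"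
    have "(\<Sum>J\<in>Pow ?N. if f ` ?N \<subseteq> J then (-1) ^ (n - card J) * d f else 0) =
        (\<Sum>J | J \<subseteq> ?N \<and> f ` ?N \<subseteq> J. (-1) ^ (card ?N - card J) * d f)"
      by (simp add: sum.inter_filter[symmetric] Pow_def conj_commute)
    also have "\<dots> = (if f ` ?N = ?N then 1 else 0) * d f"
      using f by (subst alternating_sum_supersets[symmetric]) (auto simp: sum_distrib_right PiE_iff)
    finally show "(\<Sum>J\<in>Pow ?N. if f ` ?N \<subseteq> J then (-1) ^ (n - card J) * d f else 0) =
        (if f ` ?N = ?N then d f else 0)" by simp
  qed
  also have "\<dots> = (\<Sum>f | f \<in> ?N \<rightarrow>\<^sub>E ?N \<and> f ` ?N = ?N. d f)"
    by (simp add: sum.inter_filter[OF fin])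
  also have "\<dots> = (\<Sum>p | p permutes ?N. d (restrict p ?N))"
  \<comment> \<open>Tuples are \<open>undefined\<close> off \<open>{..<n}\<close> while permutations
    fix every point there, hence restriction one way and extension by the identity the other
    way.\<close>
  proof (rule sum.reindex_bij_witness[of _ "\<lambda>p. restrict p ?N" "\<lambda>f k. if k < n then f k else k"])
    fix f assume f: "f \<in> {f. f \<in> ?N \<rightarrow>\<^sub>E ?N \<and> f ` ?N = ?N}"
    then show eq: "restrict (\<lambda>k. if k < n then f k else k) ?N = f"
      by (auto simp: fun_eq_iff PiE_iff extensional_def)
    have "inj_on f ?N"
      using f by (simp add: eq_card_imp_inj_on)
    then have "bij_betw (\<lambda>k. if k < n then f k else k) ?N ?N"
      using f by (auto simp: bij_betw_def inj_on_def image_def)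
    from bij_imp_permutes[OF this] show "(\<lambda>k. if k < n then f k else k) \<in> {p. p permutes ?N}"
      by simp
    show "d (restrict (\<lambda>k. if k < n then f k else k) ?N) = d f"
      by (simp only: eq)
  next
    fix p assume p: "p \<in> {p. p permutes ?N}"
    then show "(\<lambda>k. if k < n then restrict p ?N k else k) = p"
      by (auto simp: fun_eq_iff permutes_not_in)
    show "restrict p ?N \<in> {f. f \<in> ?N \<rightarrow>\<^sub>E ?N \<and> f ` ?N = ?N}"
      using p permutes_image[of p ?N] permutes_in_image[of p ?N] by auto
  qed
  finally show ?thesis
    by (simp add: polarization_def)
qed

text \<open>This is the source of the symmetry demanded of mixed volume coefficients, and it later
  allows an entry to be moved to the last slot.\<close>

lemma polarization_permute:
  assumes "p permutes {..<n}"
  shows "polarization n (\<lambda>J. F (p ` J)) = polarization n F"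
proof -
  have "(\<Sum>J\<in>Pow {..<n}. (-1) ^ (n - card J) * F (p ` J)) =
      (\<Sum>J\<in>Pow {..<n}. (-1) ^ (n - card (p ` J)) * F (p ` J))"
    using permutes_inj[OF assms] by (simp add: card_image inj_on_subset)
  also have "\<dots> = (\<Sum>J\<in>Pow {..<n}. (-1) ^ (n - card J) * F J)"
    using bij_betw_Pow[OF permutes_imp_bij[OF assms]]
    by (rule sum.reindex_bij_betw[where g="\<lambda>J. (-1) ^ (n - card J) * F J"])
  finally show ?thesis
    by (simp add: polarization_def)
qed

text \<open>The determinant of the matrix whose row \<open>c k\<close> is that of \<open>N k\<close>, for an enumeration \<open>c\<close> of
  the rows by \<open>{..<CARD('n)}\<close>.\<close>

definition det_rows :: "(nat \<Rightarrow> 'n) \<Rightarrow> (nat \<Rightarrow> real ^ 'n ^ 'n) \<Rightarrow> real" where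
  "det_rows c N = (\<Sum>p | p permutes UNIV. of_int (sign p) * (\<Prod>k<CARD('n). N k $ c k $ p (c k)))"

lemma det_rows_cong:
  "(\<And>k. k < CARD('n) \<Longrightarrow> N k = N' k) \<Longrightarrow> det_rows c N = det_rows c (N' :: nat \<Rightarrow> real ^ 'n ^ 'n)"
  by (simp add: det_rows_def)

lemma det_rows_scaleR:
  "det_rows c (\<lambda>k. x k *\<^sub>R N k) = (\<Prod>k<CARD('n). x k) * det_rows c (N :: nat \<Rightarrow> real ^ 'n ^ 'n)"
  by (simp add: det_rows_def prod.distrib sum_distrib_left mult_ac)

text \<open>The determinant is additive in each row, so every row \<open>c k\<close> selects its own
  summand \<open>f k\<close>.\<close>

lemma det_sum_eq_det_rows:
  fixes M :: "'j \<Rightarrow> real ^ 'n ^ 'n"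
  assumes c: "bij_betw c {..<CARD('n)} UNIV" and "finite J"
  shows "det (\<Sum>j\<in>J. M j) = (\<Sum>f\<in>{..<CARD('n)} \<rightarrow>\<^sub>E J. det_rows c (\<lambda>k. M (f k)))"
proof -
  have "det (\<Sum>j\<in>J. M j) = (\<Sum>p | p permutes UNIV. of_int (sign p) * (\<Prod>k<CARD('n). \<Sum>j\<in>J. M j $ c k $ p (c k)))"
    unfolding det_def
    by (subst prod.reindex_bij_betw[OF c, symmetric]) simp
  also have "\<dots> = (\<Sum>p | p permutes UNIV. \<Sum>f\<in>{..<CARD('n)} \<rightarrow>\<^sub>E J.
      of_int (sign p) * (\<Prod>k<CARD('n). M (f k) $ c k $ p (c k)))"
    using \<open>finite J\<close> by (simp add: prod_sum_PiE sum_distrib_left)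
  also have "\<dots> = (\<Sum>f\<in>{..<CARD('n)} \<rightarrow>\<^sub>E J. det_rows c (\<lambda>k. M (f k)))"
    unfolding det_rows_def by (rule sum.swap)
  finally show ?thesis .
qed

text \<open>The coefficient \<open>det_rows\<close> of a single tuple is in general not symmetric.
  Polarization averages it over the permutations of the tuple, which leaves the total unchanged
  because the monomial is invariant, and it involves only determinants of sub-sums. Those are the
  quantities that integrate to volumes.\<close>

lemma det_sum_polarization:
  fixes H :: "nat \<Rightarrow> real ^ 'n ^ 'n"
  shows "det (\<Sum>j<m. x j *\<^sub>R H j) =
    (\<Sum>i\<in>{..<CARD('n)} \<rightarrow>\<^sub>E {..<m}.
      polarization CARD('n) (\<lambda>J. det (\<Sum>l\<in>J. H (i l))) * (\<Prod>l<CARD('n). x (i l)))"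
proof -
  let ?n = "CARD('n)" let ?N = "{..<?n}" let ?I = "?N \<rightarrow>\<^sub>E {..<m}"
  obtain c :: "nat \<Rightarrow> 'n" where c: "bij_betw c ?N UNIV"
    using ex_bij_betw_nat_finite[of "UNIV :: 'n set"] by (auto simp: atLeast0LessThan)
  have pol: "polarization ?n (\<lambda>J. det (\<Sum>l\<in>J. H (i l))) =
      (\<Sum>p | p permutes ?N. det_rows c (\<lambda>k. H (i (p k)))) / fact ?n" for i
  proof -
    have "polarization ?n (\<lambda>J. det (\<Sum>l\<in>J. H (i l))) =
        polarization ?n (\<lambda>J. \<Sum>f\<in>?N \<rightarrow>\<^sub>E J. det_rows c (\<lambda>k. H (i (f k))))"
      unfolding polarization_def
      by (intro arg_cong2[where f="(/)"] sum.cong refl arg_cong2[where f="(*)"] det_sum_eq_det_rows c)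
        (auto intro: finite_subset)
    then show ?thesis
      unfolding polarization_sum_PiE by (simp cong: det_rows_cong)
  qed
  have perm: "(\<Sum>i\<in>?I. det_rows c (\<lambda>k. H (i (p k))) * (\<Prod>l<?n. x (i l))) = det (\<Sum>j<m. x j *\<^sub>R H j)"
    if p: "p permutes ?N" for p
  proof -
    have "(\<Sum>i\<in>?I. det_rows c (\<lambda>k. H (i (p k))) * (\<Prod>l<?n. x (i l))) =
        (\<Sum>i\<in>?I. det_rows c (\<lambda>k. H (i k)) * (\<Prod>l<?n. x (i l)))"
    proof (rule sum.reindex_bij_witness[of _ "\<lambda>i. i \<circ> inv p" "\<lambda>i. i \<circ> p"])
      fix i assume i: "i \<in> ?I"
      have q: "inv p permutes ?N" using p by (rule permutes_inv)
      show "(i \<circ> p) \<circ> inv p = i" "(i \<circ> inv p) \<circ> p = i"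
        using permutes_inv_o[OF p] by (simp_all add: o_assoc[symmetric])
      have *: "i \<circ> r \<in> ?I" if "r permutes ?N" for r
        using i permutes_in_image[OF that] permutes_not_in[OF that]
        by (auto simp: PiE_iff extensional_def)
      show "i \<circ> p \<in> ?I" "i \<circ> inv p \<in> ?I"
        using *[OF p] *[OF q] by auto
      have "(\<Prod>l<?n. x (i (p l))) = (\<Prod>l<?n. x (i l))"
        by (rule prod.reindex_bij_betw[OF permutes_imp_bij[OF p]])
      then show "det_rows c (\<lambda>k. H ((i \<circ> p) k)) * (\<Prod>l<?n. x ((i \<circ> p) l)) =
          det_rows c (\<lambda>k. H (i (p k))) * (\<Prod>l<?n. x (i l))"
        by simp
    qed
    also have "\<dots> = (\<Sum>i\<in>?I. det_rows c (\<lambda>k. x (i k) *\<^sub>R H (i k)))"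
      by (simp add: det_rows_scaleR mult.commute)
    also have "\<dots> = det (\<Sum>j<m. x j *\<^sub>R H j)"
      by (rule det_sum_eq_det_rows[OF c, symmetric]) simp
    finally show ?thesis .
  qed
  have "(\<Sum>i\<in>?I. polarization ?n (\<lambda>J. det (\<Sum>l\<in>J. H (i l))) * (\<Prod>l<?n. x (i l))) =
      (\<Sum>i\<in>?I. \<Sum>p | p permutes ?N. det_rows c (\<lambda>k. H (i (p k))) * (\<Prod>l<?n. x (i l))) / fact ?n"
    unfolding pol by (simp add: sum_divide_distrib sum_distrib_right)
  also have "(\<Sum>i\<in>?I. \<Sum>p | p permutes ?N. det_rows c (\<lambda>k. H (i (p k))) * (\<Prod>l<?n. x (i l))) =
      (\<Sum>p | p permutes ?N. \<Sum>i\<in>?I. det_rows c (\<lambda>k. H (i (p k))) * (\<Prod>l<?n. x (i l)))"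
    by (rule sum.swap)
  also have "\<dots> = fact ?n * det (\<Sum>j<m. x j *\<^sub>R H j)"
    using perm by (simp add: card_permutations)
  finally show ?thesis by simp
qed

section \<open>Mixed volumes as polarized volumes\<close>

text \<open>Uniqueness for the definite description. At the indicator vector of \<open>J\<close> the
  expansion sums the coefficients over all tuples with values in \<open>J\<close>; polarization
  returns their average over permutations, which by symmetry is the coefficient at the
  identity.\<close>

lemma mixed_volume_eq_polarization:
  fixes Ks :: "(real ^ 'n) set list"
  assumes coeffs: "is_mixed_volume_coeffs Ks c" and ne: "\<And>j. j < CARD('n) \<Longrightarrow> Ks ! j \<noteq> {}"
  shows "mixed_volume Ks = polarization CARD('n) (\<lambda>J. vol (\<Sum>l\<in>J. Ks ! l))"
proof -
  let ?n = "CARD('n)" let ?N = "{..<?n}"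
  have unique: "c' (restrict id ?N) = polarization ?n (\<lambda>J. vol (\<Sum>l\<in>J. Ks ! l))"
    if c': "is_mixed_volume_coeffs Ks c'" for c'
  proof -
    have sym: "c' (i \<circ> p) = c' i" if "i \<in> ?N \<rightarrow>\<^sub>E ?N" "p permutes ?N" for i p
      using c' that by (auto simp: is_mixed_volume_coeffs_def Let_def)
    have expand: "vol (\<Sum>j<?n. (*\<^sub>R) (x j) ` (Ks ! j)) = (\<Sum>i\<in>?N \<rightarrow>\<^sub>E ?N. c' i * (\<Prod>l<?n. x (i l)))"
      if "\<And>j. j < ?n \<Longrightarrow> 0 \<le> x j" for x
      using c' that by (auto simp: is_mixed_volume_coeffs_def Let_def)
    have "vol (\<Sum>l\<in>J. Ks ! l) = (\<Sum>f\<in>?N \<rightarrow>\<^sub>E J. c' f)" if J: "J \<subseteq> ?N" for J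
    proof -
      \<comment> \<open>Weight \<open>0\<close> collapses a nonempty set to \<open>{0}\<close>, the
        neutral element of set addition; an empty set would stay empty.\<close>
      let ?x = "\<lambda>j. if j \<in> J then 1 else 0 :: real"
      have "(\<Sum>j<?n. (*\<^sub>R) (?x j) ` (Ks ! j)) = (\<Sum>j<?n. if j \<in> J then Ks ! j else 0)"
        using ne by (intro sum.cong) (auto simp: image_constant_conv set_zero)
      also have "\<dots> = (\<Sum>l\<in>J. Ks ! l)"
        using J by (intro sum.mono_neutral_cong_right) auto
      finally have *: "(\<Sum>j<?n. (*\<^sub>R) (?x j) ` (Ks ! j)) = (\<Sum>l\<in>J. Ks ! l)" .
      have "(\<Sum>i\<in>?N \<rightarrow>\<^sub>E ?N. c' i * (\<Prod>l<?n. ?x (i l))) = (\<Sum>i\<in>?N \<rightarrow>\<^sub>E ?N. if i ` ?N \<subseteq> J then c' i else 0)"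
        by (rule sum.cong) (auto simp: prod_zero_iff image_subset_iff)
      also have "\<dots> = (\<Sum>i | i \<in> ?N \<rightarrow>\<^sub>E ?N \<and> i ` ?N \<subseteq> J. c' i)"
        by (simp add: sum.inter_filter finite_PiE)
      also have "{i. i \<in> ?N \<rightarrow>\<^sub>E ?N \<and> i ` ?N \<subseteq> J} = ?N \<rightarrow>\<^sub>E J"
        using J unfolding PiE_iff set_eq_iff mem_Collect_eq by blast
      finally show ?thesis
        using expand[of ?x] * by simp
    qed
    then have "polarization ?n (\<lambda>J. vol (\<Sum>l\<in>J. Ks ! l)) = polarization ?n (\<lambda>J. \<Sum>f\<in>?N \<rightarrow>\<^sub>E J. c' f)"
      by (simp add: polarization_def)
    also have "\<dots> = (\<Sum>p | p permutes ?N. c' (restrict id ?N)) / fact ?n"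
      unfolding polarization_sum_PiE
    proof (intro arg_cong2[where f="(/)"] sum.cong refl)
      fix p assume "p \<in> {p. p permutes ?N}"
      then have p: "p permutes ?N" by simp
      have "restrict p ?N = restrict id ?N \<circ> p"
        using permutes_in_image[OF p] by (auto simp: fun_eq_iff restrict_def)
      then show "c' (restrict p ?N) = c' (restrict id ?N)"
        using sym[of "restrict id ?N" p] p by simp
    qed
    also have "\<dots> = c' (restrict id ?N)"
      by (simp add: card_permutations)
    finally show ?thesis by simp
  qed
  show ?thesis
    unfolding mixed_volume_def using coeffs by (intro the_equality) (auto simp: unique)
qed

section \<open>Volume as an integral of Hessian determinants\<close>

text \<open>Log-sum-exp, a smooth convex majorant of the support function of
  \<open>convex hull V\<close>.\<close>

definition lse :: "'a::euclidean_space set \<Rightarrow> 'a \<Rightarrow> real" where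
  "lse V y = ln (\<Sum>v\<in>V. exp (v \<bullet> y))"

text \<open>The mean of \<open>V\<close> for weights proportional to
  \<open>exp (v \<bullet> y)\<close>.\<close>

definition lse_grad :: "'a::euclidean_space set \<Rightarrow> 'a \<Rightarrow> 'a" where
  "lse_grad V y = inverse (\<Sum>v\<in>V. exp (v \<bullet> y)) *\<^sub>R (\<Sum>v\<in>V. exp (v \<bullet> y) *\<^sub>R v)"

text \<open>The covariance operator of the same weights applied to \<open>d\<close>, in the shape
  that the product rule produces.\<close>

definition lse_hess :: "'a::euclidean_space set \<Rightarrow> 'a \<Rightarrow> 'a \<Rightarrow> 'a" where
  "lse_hess V y d = inverse (\<Sum>v\<in>V. exp (v \<bullet> y)) *\<^sub>R (\<Sum>v\<in>V. (exp (v \<bullet> y) * (v \<bullet> d)) *\<^sub>R v)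
    - (inverse (\<Sum>v\<in>V. exp (v \<bullet> y)) * (\<Sum>v\<in>V. exp (v \<bullet> y) * (v \<bullet> d)) *
       inverse (\<Sum>v\<in>V. exp (v \<bullet> y))) *\<^sub>R (\<Sum>v\<in>V. exp (v \<bullet> y) *\<^sub>R v)"

lemma sum_exp_pos: "finite V \<Longrightarrow> V \<noteq> {} \<Longrightarrow> 0 < (\<Sum>v\<in>V. exp (v \<bullet> y :: real))"
  by (rule sum_pos) auto

lemma has_derivative_sum_exp:
  "((\<lambda>y. \<Sum>v\<in>V. exp (v \<bullet> y :: real)) has_derivative (\<lambda>d. \<Sum>v\<in>V. exp (v \<bullet> y) * (v \<bullet> d))) (at y)"
  by (rule has_derivative_sum) (auto intro!: derivative_eq_intros)

lemma has_derivative_lse: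
  assumes "finite V" "V \<noteq> {}"
  shows "(lse V has_derivative (\<lambda>d. lse_grad V y \<bullet> d)) (at y)"
proof -
  have "(lse V has_derivative (\<lambda>d. inverse (\<Sum>v\<in>V. exp (v \<bullet> y)) * (\<Sum>v\<in>V. exp (v \<bullet> y) * (v \<bullet> d)))) (at y)"
    unfolding lse_def[abs_def]
    using has_derivative_ln[OF sum_exp_pos[OF assms] has_derivative_sum_exp, of y]
    by (simp add: mult.commute)
  then show ?thesis
    by (simp add: lse_grad_def inner_sum_left)
qed

lemma has_derivative_lse_grad:
  assumes "finite V" "V \<noteq> {}"
  shows "(lse_grad V has_derivative lse_hess V y) (at y)"
proof -
  have "((\<lambda>y. \<Sum>v\<in>V. exp (v \<bullet> y) *\<^sub>R v) has_derivative (\<lambda>d. \<Sum>v\<in>V. (exp (v \<bullet> y) * (v \<bullet> d)) *\<^sub>R v)) (at y)"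
    by (rule has_derivative_sum) (auto intro!: derivative_eq_intros)
  from has_derivative_scaleR[OF Deriv.has_derivative_inverse[OF _ has_derivative_sum_exp] this]
  show ?thesis
    unfolding lse_grad_def[abs_def] lse_hess_def[abs_def]
    using sum_exp_pos[OF assms, of y] by simp
qed

lemma lse_grad_in_hull:
  assumes "finite V" "V \<noteq> {}"
  shows "lse_grad V y \<in> convex hull V"
proof -
  let ?Z = "\<Sum>v\<in>V. exp (v \<bullet> y)"
  have "lse_grad V y = (\<Sum>v\<in>V. (inverse ?Z * exp (v \<bullet> y)) *\<^sub>R v)"
    by (simp add: lse_grad_def scaleR_sum_right)
  also have "\<dots> \<in> convex hull V"
    using sum_exp_pos[OF assms, of y] assms
    by (intro convex_sum convex_convex_hull) (auto simp: hull_inc simp flip: sum_distrib_left)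
  finally show ?thesis .
qed

text \<open>A single term bounds the sum of exponentials from below. The coercivity used later rests
  on this.\<close>

lemma support_fun_hull_le_lse:
  assumes "finite V" "V \<noteq> {}"
  shows "support_fun (convex hull V) y \<le> lse V y"
proof -
  have body: "convex hull V \<in> conv_bodies"
    using assms by (simp add: conv_bodies_def finite_imp_compact_convex_hull)
  have "v \<bullet> y \<le> lse V y" if "v \<in> V" for v
  proof -
    have "exp (v \<bullet> y) \<le> (\<Sum>v\<in>V. exp (v \<bullet> y))"
      using assms that by (intro member_le_sum) auto
    then show ?thesis
      unfolding lse_def using sum_exp_pos[OF assms] by (simp add: ln_ge_iff)
  qed
  then have "convex hull V \<subseteq> {x. y \<bullet> x \<le> lse V y}"
    by (intro hull_minimal convex_halfspace_le) (auto simp: inner_commute)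
  then show ?thesis
    using support_fun_attained[OF body, of y] by (auto simp: inner_commute)
qed

text \<open>\<open>d \<bullet> lse_hess V y d\<close> is the variance of \<open>v \<bullet> d\<close> for the Gibbs weights \<open>exp (v \<bullet> y)\<close>.\<close>

lemma lse_hess_pos:
  assumes V: "finite V" "interior (convex hull V) \<noteq> {}" and "d \<noteq> 0"
  shows "0 < d \<bullet> lse_hess V y d"
proof -
  define w where "w v = exp (v \<bullet> y)" for v
  define a where "a v = v \<bullet> d" for v
  define Z where "Z = (\<Sum>v\<in>V. w v)"
  define m where "m = (\<Sum>v\<in>V. w v * a v) / Z"
  have "V \<noteq> {}" using V by auto
  have Z: "0 < Z"
    unfolding Z_def w_def using sum_exp_pos[OF V(1) \<open>V \<noteq> {}\<close>] .
  have "\<exists>v\<in>V. a v \<noteq> m"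
  proof (rule ccontr)
    assume "\<not> (\<exists>v\<in>V. a v \<noteq> m)"
    then have "convex hull V \<subseteq> {x. d \<bullet> x = m}"
      by (intro hull_minimal convex_hyperplane) (auto simp: a_def inner_commute)
    then have "interior (convex hull V) \<subseteq> {}"
      using interior_mono interior_hyperplane[OF \<open>d \<noteq> 0\<close>] by metis
    with V show False by simp
  qed
  then obtain v where v: "v \<in> V" "a v \<noteq> m" by blast
  have "0 < (\<Sum>v\<in>V. w v * (a v - m)\<^sup>2)"
    using V v by (intro sum_pos2[of _ v]) (auto simp: w_def)
  also have "\<dots> = (\<Sum>v\<in>V. w v * a v * a v) - 2 * m * (\<Sum>v\<in>V. w v * a v) + m * m * Z"
    unfolding Z_def sum_distrib_left by (simp add: sum_subtractf[symmetric] sum.distrib[symmetric] power2_eq_square algebra_simps)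
  also have "\<dots> = (\<Sum>v\<in>V. w v * a v * a v) - m * (\<Sum>v\<in>V. w v * a v)"
    using Z by (simp add: m_def)
  also have "\<dots> = Z * (d \<bullet> lse_hess V y d)"
    using Z unfolding lse_hess_def w_def[symmetric] a_def[symmetric] Z_def[symmetric] m_def
    by (simp add: inner_diff_right inner_sum_right inner_commute[of d] a_def[symmetric] field_simps)
  finally show ?thesis
    using Z by (simp add: zero_less_mult_iff)
qed

section \<open>Gradient maps and change of variables\<close>

text \<open>On the segment from \<open>y\<close> to \<open>z\<close> the component of
  \<open>G\<close> along \<open>z - y\<close> is strictly increasing.\<close>

lemma inj_if_derivative_pos:
  fixes G :: "'a::real_inner \<Rightarrow> 'a"
  assumes der: "\<And>y. (G has_derivative G' y) (at y)"
    and pos: "\<And>y d. d \<noteq> 0 \<Longrightarrow> 0 < d \<bullet> G' y d"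
  shows "inj G"
proof (rule injI, rule ccontr)
  fix y z assume eq: "G y = G z" and "y \<noteq> z"
  let ?d = "z - y"
  define \<psi> where "\<psi> s = ?d \<bullet> G (y + s *\<^sub>R ?d)" for s
  have der_\<psi>: "(\<psi> has_real_derivative ?d \<bullet> G' (y + s *\<^sub>R ?d) ?d) (at s)" for s
  proof -
    have lin: "linear (G' (y + s *\<^sub>R ?d))"
      using der by (rule has_derivative_linear)
    have "((\<lambda>s. y + s *\<^sub>R ?d) has_derivative (\<lambda>h. h *\<^sub>R ?d)) (at s)"
      by (auto intro!: derivative_eq_intros)
    from has_derivative_compose[OF this der]
    have "(\<psi> has_derivative (\<lambda>h. ?d \<bullet> G' (y + s *\<^sub>R ?d) (h *\<^sub>R ?d))) (at s)"
      unfolding \<psi>_def[abs_def] by (rule has_derivative_inner_right)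
    moreover have "(\<lambda>h. ?d \<bullet> G' (y + s *\<^sub>R ?d) (h *\<^sub>R ?d)) = (*) (?d \<bullet> G' (y + s *\<^sub>R ?d) ?d)"
      by (rule ext) (simp only: linear_scale[OF lin] inner_scaleR_right mult.commute)
    ultimately show ?thesis
      unfolding has_field_derivative_def by (simp only:)
  qed
  have "?d \<noteq> 0"
    using \<open>y \<noteq> z\<close> by simp
  have "\<psi> 0 < \<psi> 1"
    by (rule DERIV_pos_imp_increasing[OF zero_less_one]) (use der_\<psi> pos[OF \<open>?d \<noteq> 0\<close>] in blast)
  then show False
    by (simp add: \<psi>_def eq)
qed

text \<open>On the segment of matrices from the identity to \<open>matrix f\<close> the quadratic
  form stays positive, so the determinant never vanishes and keeps its sign. This removes the
  absolute value from the Jacobian.\<close>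

lemma det_matrix_pos:
  fixes f :: "real ^ 'n \<Rightarrow> real ^ 'n"
  assumes f: "linear f" and pos: "\<And>d. d \<noteq> 0 \<Longrightarrow> 0 < d \<bullet> f d"
  shows "0 < det (matrix f)"
proof (rule ccontr)
  assume neg: "\<not> 0 < det (matrix f)"
  define M where "M t = (1 - t) *\<^sub>R mat 1 + t *\<^sub>R matrix f" for t :: real
  have "continuous_on {0..1} (\<lambda>t. det (M t))"
    unfolding det_def M_def by (intro continuous_intros)
  moreover have "det (M 0) = 1" "det (M 1) = det (matrix f)"
    by (simp_all add: M_def)
  ultimately obtain t where t: "0 \<le> t" "t \<le> 1" "det (M t) = 0"
    using IVT2'[of "\<lambda>t. det (M t)" 1 0 0] neg by auto
  then obtain d where d: "M t *v d = 0" "d \<noteq> 0"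
    using matrix_left_invertible_ker[of "M t"] invertible_det_nz[of "M t"]
    by (auto simp: invertible_left_inverse)
  have "M t *v d = (1 - t) *\<^sub>R d + t *\<^sub>R f d"
    using f by (simp add: M_def matrix_vector_mult_add_rdistrib scaleR_matrix_vector_assoc[symmetric] matrix_works linear_def)
  then have "(1 - t) * (d \<bullet> d) + t * (d \<bullet> f d) = 0"
    using d by (metis inner_add_right inner_scaleR_right inner_zero_right)
  moreover have "0 < (1 - t) * (d \<bullet> d) + t * (d \<bullet> f d)"
  proof (cases "t = 0")
    case False
    then have "0 < t * (d \<bullet> f d)" using t pos[OF d(2)] by simp
    then show ?thesis using t by (simp add: add_nonneg_pos)
  qed (use d in simp)
  ultimately show False by simp
qed

text \<open>\<open>F y - p \<bullet> y\<close> is coercive for \<open>p\<close> in the interior of \<open>Q\<close>, so it attains its minimum,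
  where the gradient of \<open>F\<close> is \<open>p\<close>.\<close>

lemma interior_subset_range_gradient:
  fixes F :: "'a::euclidean_space \<Rightarrow> real"
  assumes Q: "Q \<in> conv_bodies" and der: "\<And>y. (F has_derivative (\<lambda>d. G y \<bullet> d)) (at y)"
    and ge: "\<And>y. support_fun Q y \<le> F y"
  shows "interior Q \<subseteq> range G"
proof
  fix p assume "p \<in> interior Q"
  then obtain e where e: "0 < e" "cball p e \<subseteq> Q"
    by (meson mem_interior_cball)
  define f where "f y = F y - p \<bullet> y" for y
  have f_ge: "e * norm y \<le> f y" for y
    using ge[of y] support_fun_ge_cball[OF Q e(2), of y] e(1) by (simp add: f_def)
  have der_f: "(f has_derivative (\<lambda>d. G y \<bullet> d - p \<bullet> d)) (at y)" for y
    unfolding f_def[abs_def] by (intro has_derivative_diff der has_derivative_inner_right has_derivative_ident)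
  \<comment> \<open>Beyond this radius \<open>e * norm z\<close> exceeds \<open>F 0\<close>, the
    value of \<open>f\<close> at the origin, so the minimum over the ball is global.\<close>
  define R where "R = F 0 / e + 1"
  have "0 \<le> F 0" using f_ge[of 0] by (simp add: f_def)
  then have R: "0 < R" using e by (simp add: R_def add_nonneg_pos)
  have "continuous_on (cball 0 R) f"
    using der_f by (meson has_derivative_at_withinI has_derivative_continuous_on)
  then obtain y where y: "\<And>z. z \<in> cball 0 R \<Longrightarrow> f y \<le> f z"
    using continuous_attains_inf[of "cball 0 R" f] R by (metis cball_eq_empty compact_cball not_less_iff_gr_or_eq)
  have "f y \<le> f z" for z
  proof (cases "z \<in> cball 0 R")
    case False
    then have "R < norm z" by simp
    then have "F 0 < e * norm z" using e by (simp add: R_def field_simps)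
    then show ?thesis
      using f_ge[of z] y[of 0] R by (simp add: f_def)
  qed (rule y)
  then have "(\<lambda>d. G y \<bullet> d - p \<bullet> d) = (\<lambda>d. 0)"
    using differential_zero_maxmin[OF _ open_UNIV der_f, of y] by auto
  then have "(G y - p) \<bullet> (G y - p) = 0"
    by (metis inner_diff_left)
  then have "p = G y" by simp
  then show "p \<in> range G" by (rule range_eqI)
qed

text \<open>The range of the gradient lies between the interior of the body and the body itself.
  These differ by part of the frontier, which is negligible by convexity, so the range has the
  volume of the body.\<close>

lemma has_integral_det_lse_hess:
  fixes V :: "'j \<Rightarrow> (real ^ 'n::{finite,wellorder}) set"
  assumes S: "finite S" and V: "\<And>j. j \<in> S \<Longrightarrow> finite (V j) \<and> interior (convex hull V j) \<noteq> {}"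
    and x: "\<And>j. j \<in> S \<Longrightarrow> 0 \<le> x j"
  shows "((\<lambda>y. det (\<Sum>j\<in>S. x j *\<^sub>R matrix (lse_hess (V j) y))) has_integral
      vol (\<Sum>j\<in>S. (*\<^sub>R) (x j) ` (convex hull V j))) UNIV"
proof (cases "\<forall>j\<in>S. x j = 0")
  \<comment> \<open>Here the gradient map is constant and not injective, but both sides are
    \<open>0\<close>. The empty index set, which occurs in polarization as \<open>J = {}\<close>,
    falls under this case.\<close>
  case True
  have ne: "V j \<noteq> {}" if "j \<in> S" for j using V[OF that] by auto
  have "(\<Sum>j\<in>S. (*\<^sub>R) (x j) ` (convex hull V j)) = (\<Sum>j\<in>S. 0)"
    using True ne by (intro sum.cong) (auto simp: image_constant_conv)
  also have "\<dots> = {0}" unfolding sum.neutral_const by (rule set_zero)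
  finally have "vol (\<Sum>j\<in>S. (*\<^sub>R) (x j) ` (convex hull V j)) = 0" by simp
  moreover have "det (\<Sum>j\<in>S. x j *\<^sub>R matrix (lse_hess (V j) y)) = 0" for y
    using True by (simp add: det_zero_row(1)[of undefined] row_def vec_eq_iff)
  ultimately show ?thesis by (simp only: has_integral_0)
next
  case False
  then obtain k where k: "k \<in> S" "0 < x k"
    using x by force
  have ne: "V j \<noteq> {}" if "j \<in> S" for j using V[OF that] by auto
  define Q where "Q = (\<Sum>j\<in>S. (*\<^sub>R) (x j) ` (convex hull V j))"
  define G where "G y = (\<Sum>j\<in>S. x j *\<^sub>R lse_grad (V j) y)" for y
  define G' where "G' y d = (\<Sum>j\<in>S. x j *\<^sub>R lse_hess (V j) y d)" for y d
  have hull: "convex hull V j \<in> conv_bodies" if "j \<in> S" for j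
    using V[OF that] ne[OF that] by (simp add: conv_bodies_def finite_imp_compact_convex_hull)
  have Q: "Q \<in> conv_bodies"
    unfolding Q_def by (intro conv_bodies_sum conv_bodies_scaleR hull)
  have der: "(G has_derivative G' y) (at y)" for y
    unfolding G_def[abs_def] G'_def[abs_def] using V ne
    by (intro has_derivative_sum has_derivative_scaleR_right has_derivative_lse_grad) auto
  have pos: "0 < d \<bullet> G' y d" if "d \<noteq> 0" for y d
  proof -
    have p: "0 < d \<bullet> lse_hess (V j) y d" if "j \<in> S" for j
      using V[OF that] \<open>d \<noteq> 0\<close> by (intro lse_hess_pos) auto
    have "0 < (\<Sum>j\<in>S. x j * (d \<bullet> lse_hess (V j) y d))"
      using k x p by (intro sum_pos2[OF S k(1)]) (auto simp: less_imp_le)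
    then show ?thesis
      by (simp add: G'_def inner_sum_right)
  qed
  have lin_j: "linear (lse_hess (V j) y)" if "j \<in> S" for j y
    using has_derivative_lse_grad[of "V j" y] V[OF that] ne[OF that] has_derivative_linear by blast
  have lin: "linear (G' y)" for y
    using der has_derivative_linear by blast
  have mat: "matrix (G' y) = (\<Sum>j\<in>S. x j *\<^sub>R matrix (lse_hess (V j) y))" for y
    by (simp add: matrix_def G'_def vec_eq_iff)
  have "interior Q \<subseteq> range G"
  proof (rule interior_subset_range_gradient[OF Q])
    show "((\<lambda>y. \<Sum>j\<in>S. x j * lse (V j) y) has_derivative (\<lambda>d. G y \<bullet> d)) (at y)" for y
      unfolding G_def inner_sum_left inner_scaleR_left using V ne
      by (intro has_derivative_sum has_derivative_mult_right has_derivative_lse) auto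
    show "support_fun Q y \<le> (\<Sum>j\<in>S. x j * lse (V j) y)" for y
    proof -
      have "support_fun Q y = (\<Sum>j\<in>S. x j * support_fun (convex hull V j) y)"
        unfolding Q_def using hull x by (simp add: support_fun_sum support_fun_scaleR conv_bodies_scaleR)
      also have "\<dots> \<le> (\<Sum>j\<in>S. x j * lse (V j) y)"
        using V ne x by (intro sum_mono mult_left_mono support_fun_hull_le_lse) auto
      finally show ?thesis .
    qed
  qed
  moreover have "range G \<subseteq> Q"
  proof
    fix p assume "p \<in> range G"
    then obtain y where p: "p = (\<Sum>j\<in>S. x j *\<^sub>R lse_grad (V j) y)"
      by (auto simp: G_def)
    have "x j *\<^sub>R lse_grad (V j) y \<in> (*\<^sub>R) (x j) ` (convex hull V j)" if "j \<in> S" for j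
      using V[OF that] ne[OF that] by (intro imageI lse_grad_in_hull) auto
    then show "p \<in> Q"
      unfolding Q_def p set_sum_alt[OF S] by blast
  qed
  ultimately have range: "range G \<in> lmeasurable" "vol (range G) = vol Q"
  proof -
    have fr: "negligible (Q - interior Q)"
      using Q negligible_convex_frontier[of Q]
      by (auto simp: conv_bodies_def frontier_def compact_imp_closed)
    assume sub: "interior Q \<subseteq> range G" "range G \<subseteq> Q"
    have "negligible (sym_diff Q (range G))"
      using sub by (intro negligible_subset[OF fr]) auto
    then show "range G \<in> lmeasurable" "vol (range G) = vol Q"
      using lmeasurable_negligible_symdiff[of Q "range G"] measure_negligible_symdiff[of Q "range G"]
        lmeasurable_compact[OF conv_bodies_compact[OF Q]]
      by blast+
  qed
  then have "((\<lambda>y. \<bar>det (matrix (G' y))\<bar>) has_integral vol Q) UNIV"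
    using has_measure_differentiable_image[of UNIV G G' "vol Q"] der inj_if_derivative_pos[OF der pos]
    by auto
  moreover have "\<bar>det (matrix (G' y))\<bar> = det (\<Sum>j\<in>S. x j *\<^sub>R matrix (lse_hess (V j) y))" for y
    using det_matrix_pos[OF lin pos, of y] by (simp add: mat)
  ultimately show ?thesis
    by (simp add: Q_def)
qed

section \<open>Minkowski's expansion\<close>

lemma has_integral_polarization:
  assumes "\<And>J. J \<subseteq> {..<n} \<Longrightarrow> (f J has_integral a J) S"
  shows "((\<lambda>y. polarization n (\<lambda>J. f J y)) has_integral polarization n a) S"
  unfolding polarization_def using assms
  by (intro has_integral_divide has_integral_sum has_integral_mult_right) auto

lemma tendsto_polarization:
  assumes "\<And>J. J \<subseteq> {..<n} \<Longrightarrow> ((\<lambda>k. f J k) \<longlongrightarrow> a J) F"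
  shows "((\<lambda>k. polarization n (\<lambda>J. f J k)) \<longlongrightarrow> polarization n a) F"
  unfolding polarization_def using assms by (intro tendsto_intros) auto

text \<open>Both sides are integrals of the same determinant; on the right it is expanded by
  polarization, and the determinant of each sub-sum is integrated with all weights equal to
  \<open>1\<close>.\<close>

lemma minkowski_expansion_polytopes:
  fixes V :: "nat \<Rightarrow> (real ^ 'n::{finite,wellorder}) set"
  assumes V: "\<And>j. j < m \<Longrightarrow> finite (V j) \<and> interior (convex hull V j) \<noteq> {}"
    and x: "\<And>j. j < m \<Longrightarrow> 0 \<le> x j"
  shows "vol (\<Sum>j<m. (*\<^sub>R) (x j) ` (convex hull V j)) =
    (\<Sum>i\<in>{..<CARD('n)} \<rightarrow>\<^sub>E {..<m}.
      polarization CARD('n) (\<lambda>J. vol (\<Sum>l\<in>J. convex hull V (i l))) * (\<Prod>l<CARD('n). x (i l)))"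
proof (rule has_integral_unique)
  let ?n = "CARD('n)" and ?H = "\<lambda>j y. matrix (lse_hess (V j) y)"
  show "((\<lambda>y. det (\<Sum>j<m. x j *\<^sub>R ?H j y)) has_integral vol (\<Sum>j<m. (*\<^sub>R) (x j) ` (convex hull V j))) UNIV"
    using V x by (intro has_integral_det_lse_hess) auto
  show "((\<lambda>y. det (\<Sum>j<m. x j *\<^sub>R ?H j y)) has_integral (\<Sum>i\<in>{..<?n} \<rightarrow>\<^sub>E {..<m}.
      polarization ?n (\<lambda>J. vol (\<Sum>l\<in>J. convex hull V (i l))) * (\<Prod>l<?n. x (i l)))) UNIV"
    unfolding det_sum_polarization
  proof (intro has_integral_sum has_integral_mult_left has_integral_polarization)
    fix i J assume i: "i \<in> {..<?n} \<rightarrow>\<^sub>E {..<m}" and J: "J \<subseteq> {..<?n}"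
    have "((\<lambda>y. det (\<Sum>l\<in>J. 1 *\<^sub>R ?H (i l) y)) has_integral
        vol (\<Sum>l\<in>J. (*\<^sub>R) 1 ` (convex hull V (i l)))) UNIV"
      using i J V by (intro has_integral_det_lse_hess) (auto intro: finite_subset)
    then show "((\<lambda>y. det (\<Sum>l\<in>J. ?H (i l) y)) has_integral vol (\<Sum>l\<in>J. convex hull V (i l))) UNIV"
      by simp
  qed (simp add: finite_PiE)
qed

section \<open>Approximation from inside by polytopes\<close>

text \<open>Closeness is measured by homothety instead of Hausdorff distance: the relation passes to
  Minkowski sums and scalings with the same \<open>e\<close> and compares volumes directly.\<close>

definition inner_approx :: "real \<Rightarrow> 'a::euclidean_space set \<Rightarrow> 'a set \<Rightarrow> bool" where
  "inner_approx e P K \<longleftrightarrow> P \<subseteq> K \<and> (\<exists>z. (+) z ` (*\<^sub>R) (1 - e) ` K \<subseteq> P)"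

lemma inner_approx_plus:
  assumes "inner_approx e P K" "inner_approx e Q L"
  shows "inner_approx e (P + Q) (K + L)"
proof -
  obtain z w where z: "(+) z ` (*\<^sub>R) (1 - e) ` K \<subseteq> P" and w: "(+) w ` (*\<^sub>R) (1 - e) ` L \<subseteq> Q"
    using assms by (auto simp: inner_approx_def)
  have "(+) (z + w) ` (*\<^sub>R) (1 - e) ` (K + L) \<subseteq> P + Q"
  proof clarify
    fix y assume "y \<in> K + L"
    then obtain a b where ab: "y = a + b" "a \<in> K" "b \<in> L" by (auto elim: set_plus_elim)
    then have "(z + (1 - e) *\<^sub>R a) + (w + (1 - e) *\<^sub>R b) \<in> P + Q"
      using z w by (intro set_plus_intro) auto
    then show "z + w + (1 - e) *\<^sub>R y \<in> P + Q"
      by (simp add: ab algebra_simps)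
  qed
  moreover have "P + Q \<subseteq> K + L"
    using assms by (intro set_plus_mono2) (auto simp: inner_approx_def)
  ultimately show ?thesis
    unfolding inner_approx_def by blast
qed

lemma inner_approx_sum:
  "(\<And>i. i \<in> I \<Longrightarrow> inner_approx e (P i) (K i)) \<Longrightarrow> inner_approx e (\<Sum>i\<in>I. P i) (\<Sum>i\<in>I. K i)"
proof (induction I rule: infinite_finite_induct)
  case (insert i I)
  then show ?case by (simp add: inner_approx_plus)
qed (auto simp: inner_approx_def)

lemma inner_approx_scaleR:
  assumes "inner_approx e P K"
  shows "inner_approx e ((*\<^sub>R) c ` P) ((*\<^sub>R) c ` K)"
proof -
  obtain z where z: "(+) z ` (*\<^sub>R) (1 - e) ` K \<subseteq> P" and "P \<subseteq> K"
    using assms by (auto simp: inner_approx_def)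
  have "(+) (c *\<^sub>R z) ` (*\<^sub>R) (1 - e) ` (*\<^sub>R) c ` K \<subseteq> (*\<^sub>R) c ` P"
  proof clarify
    fix y assume "y \<in> K"
    then have "c *\<^sub>R (z + (1 - e) *\<^sub>R y) \<in> (*\<^sub>R) c ` P"
      using z by auto
    then show "c *\<^sub>R z + (1 - e) *\<^sub>R c *\<^sub>R y \<in> (*\<^sub>R) c ` P"
      by (simp add: scaleR_add_right mult.commute)
  qed
  with \<open>P \<subseteq> K\<close> show ?thesis
    unfolding inner_approx_def by blast
qed

lemma inner_approx_vol:
  fixes P K :: "'a::euclidean_space set"
  assumes "inner_approx e P K" "compact P" "compact K"
  shows "\<bar>1 - e\<bar> ^ DIM('a) * vol K \<le> vol P" "vol P \<le> vol K"
proof -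
  obtain z where z: "(+) z ` (*\<^sub>R) (1 - e) ` K \<subseteq> P" and "P \<subseteq> K"
    using assms by (auto simp: inner_approx_def)
  have "compact ((+) z ` (*\<^sub>R) (1 - e) ` K)"
    using assms by (intro compact_translation compact_scaling)
  from vol_mono[OF z this \<open>compact P\<close>] show "\<bar>1 - e\<bar> ^ DIM('a) * vol K \<le> vol P"
    by (simp only: vol_translation_scaleR)
  show "vol P \<le> vol K"
    using \<open>P \<subseteq> K\<close> assms by (intro vol_mono)
qed

text \<open>The copy of \<open>K\<close> shrunk towards an interior point is a compact subset of the
  interior. The interiors of finitely many boxes inside \<open>K\<close> cover it, and the hull of
  all their vertices is the polytope.\<close>

lemma inner_approx_polytope:
  fixes K :: "'a::euclidean_space set"
  assumes K: "K \<in> conv_bodies" "interior K \<noteq> {}" and e: "0 < e" "e < 1"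
  shows "\<exists>V. finite V \<and> interior (convex hull V) \<noteq> {} \<and> inner_approx e (convex hull V) K"
proof -
  obtain c where c: "c \<in> interior K" using K by auto
  define T where "T = (+) (e *\<^sub>R c) ` (*\<^sub>R) (1 - e) ` K"
  have "\<forall>y\<in>T. \<exists>V. finite V \<and> y \<in> interior (convex hull V) \<and> convex hull V \<subseteq> K"
  proof
    fix y assume y: "y \<in> T"
    obtain k where k: "k \<in> K" "y = e *\<^sub>R c + (1 - e) *\<^sub>R k"
      using y unfolding T_def image_image by (rule imageE) simp
    have "k - e *\<^sub>R (k - c) \<in> interior K"
      using K c k e by (intro mem_interior_convex_shrink) (auto simp: conv_bodies_def)
    moreover have "k - e *\<^sub>R (k - c) = y"
      unfolding k(2) by (simp add: algebra_simps)
    ultimately have "y \<in> interior K" by simp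
    then obtain a b where ab: "y \<in> box a b" "cbox a b \<subseteq> interior K"
      by (rule open_contains_cbox[OF open_interior])
    obtain V where V: "finite V" "cbox a b = convex hull V"
      by (rule closed_interval_as_convex_hull)
    have "y \<in> interior (convex hull V)"
      unfolding V(2)[symmetric] interior_cbox by (rule ab)
    moreover have "convex hull V \<subseteq> K"
      unfolding V(2)[symmetric] using ab(2) interior_subset by (rule order_trans)
    ultimately show "\<exists>V. finite V \<and> y \<in> interior (convex hull V) \<and> convex hull V \<subseteq> K"
      using V(1) by (intro exI[of _ V] conjI)
  qed
  from bchoice[OF this] obtain W where
    W: "\<forall>y\<in>T. finite (W y) \<and> y \<in> interior (convex hull W y) \<and> convex hull W y \<subseteq> K"
    by (elim exE)
  have comp: "compact T"
    unfolding T_def using K by (intro compact_translation compact_scaling conv_bodies_compact)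
  have "T \<subseteq> (\<Union>y\<in>T. interior (convex hull W y))"
  proof
    fix y assume "y \<in> T"
    with W show "y \<in> (\<Union>y\<in>T. interior (convex hull W y))"
      by (intro UN_I[of y]) simp_all
  qed
  from compactE_image[OF comp open_interior this]
  obtain Y where Y: "Y \<subseteq> T" "finite Y" "T \<subseteq> (\<Union>y\<in>Y. interior (convex hull W y))" .
  define V where "V = (\<Union>y\<in>Y. W y)"
  have W': "finite (W y)" "convex hull W y \<subseteq> K" if "y \<in> Y" for y
    using W subsetD[OF Y(1) that] by simp_all
  have fin: "finite V"
    unfolding V_def using Y(2) W'(1) by (rule finite_UN_I)
  have hull_T: "T \<subseteq> convex hull V"
  proof
    fix z assume "z \<in> T"
    then obtain y where y: "y \<in> Y" "z \<in> interior (convex hull W y)"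
      using Y(3) by blast
    then have "z \<in> convex hull W y"
      by (meson interior_subset subsetD)
    with y(1) show "z \<in> convex hull V"
      using hull_mono[of "W y" V convex] by (auto simp: V_def)
  qed
  have "V \<subseteq> K"
    unfolding V_def by (rule UN_least) (rule order_trans[OF hull_subset W'(2)])
  then have "convex hull V \<subseteq> K"
    using K by (intro hull_minimal) (auto simp: conv_bodies_def)
  with hull_T have approx: "inner_approx e (convex hull V) K"
    unfolding inner_approx_def T_def by (intro conjI exI[of _ "e *\<^sub>R c"])
  \<comment> \<open>A convex set of positive volume has interior points; the shrunk copy provides
    the volume.\<close>
  have "0 < \<bar>1 - e\<bar> ^ DIM('a) * vol K"
    using vol_pos[OF K] e by simp
  also have "\<dots> \<le> vol (convex hull V)"
    using inner_approx_vol(1)[OF approx finite_imp_compact_convex_hull[OF fin] conv_bodies_compact[OF K(1)]] .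
  finally have "interior (convex hull V) \<noteq> {}"
    by (rule vol_pos_imp_interior[OF convex_convex_hull])
  with fin approx show ?thesis
    by (intro exI[of _ V] conjI)
qed

lemma tendsto_vol_sum_inner_approx:
  fixes P :: "nat \<Rightarrow> 'i \<Rightarrow> 'a::euclidean_space set"
  assumes e: "e \<longlonglongrightarrow> 0" and approx: "\<And>k i. i \<in> I \<Longrightarrow> inner_approx (e k) (P k i) (K i)"
    and P: "\<And>k i. i \<in> I \<Longrightarrow> P k i \<in> conv_bodies" and K: "\<And>i. i \<in> I \<Longrightarrow> K i \<in> conv_bodies"
  shows "(\<lambda>k. vol (\<Sum>i\<in>I. P k i)) \<longlonglongrightarrow> vol (\<Sum>i\<in>I. K i)"
proof (rule tendsto_sandwich)
  have bounds: "\<bar>1 - e k\<bar> ^ DIM('a) * vol (\<Sum>i\<in>I. K i) \<le> vol (\<Sum>i\<in>I. P k i)"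
    "vol (\<Sum>i\<in>I. P k i) \<le> vol (\<Sum>i\<in>I. K i)" for k
  proof -
    have "compact (\<Sum>i\<in>I. P k i)" "compact (\<Sum>i\<in>I. K i)"
      using P K by (simp_all add: conv_bodies_compact conv_bodies_sum)
    from inner_approx_vol[OF inner_approx_sum[OF approx] this]
    show "\<bar>1 - e k\<bar> ^ DIM('a) * vol (\<Sum>i\<in>I. K i) \<le> vol (\<Sum>i\<in>I. P k i)"
      "vol (\<Sum>i\<in>I. P k i) \<le> vol (\<Sum>i\<in>I. K i)" by simp_all
  qed
  then show "\<forall>\<^sub>F k in sequentially. \<bar>1 - e k\<bar> ^ DIM('a) * vol (\<Sum>i\<in>I. K i) \<le> vol (\<Sum>i\<in>I. P k i)"
    "\<forall>\<^sub>F k in sequentially. vol (\<Sum>i\<in>I. P k i) \<le> vol (\<Sum>i\<in>I. K i)"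
    by auto
  have "(\<lambda>k. \<bar>1 - e k\<bar> ^ DIM('a) * vol (\<Sum>i\<in>I. K i)) \<longlonglongrightarrow> \<bar>1 - 0\<bar> ^ DIM('a) * vol (\<Sum>i\<in>I. K i)"
    by (intro tendsto_intros e)
  then show "(\<lambda>k. \<bar>1 - e k\<bar> ^ DIM('a) * vol (\<Sum>i\<in>I. K i)) \<longlonglongrightarrow> vol (\<Sum>i\<in>I. K i)"
    by simp
qed (rule tendsto_const)

lemma minkowski_expansion_wellorder:
  fixes K :: "nat \<Rightarrow> (real ^ 'n::{finite,wellorder}) set"
  assumes K: "\<And>j. j < m \<Longrightarrow> K j \<in> conv_bodies \<and> interior (K j) \<noteq> {}"
    and x: "\<And>j. j < m \<Longrightarrow> 0 \<le> x j"
  shows "vol (\<Sum>j<m. (*\<^sub>R) (x j) ` K j) =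
    (\<Sum>i\<in>{..<CARD('n)} \<rightarrow>\<^sub>E {..<m}.
      polarization CARD('n) (\<lambda>J. vol (\<Sum>l\<in>J. K (i l))) * (\<Prod>l<CARD('n). x (i l)))"
proof -
  \<comment> \<open>The shift by \<open>2\<close> keeps \<open>e k\<close> strictly below
    \<open>1\<close> for \<open>k = 0\<close> as well.\<close>
  define e where "e k = 1 / real (k + 2)" for k
  have e: "e \<longlonglongrightarrow> 0"
    unfolding e_def using LIMSEQ_ignore_initial_segment[OF lim_1_over_n, of 2] by simp
  have "0 < e k" "e k < 1" for k
    by (auto simp: e_def)
  then have ex: "\<exists>V. finite V \<and> interior (convex hull V) \<noteq> {} \<and> inner_approx (e k) (convex hull V) (K j)"
    if "j < m" for k j
    using K that by (intro inner_approx_polytope) auto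
  define V where "V k j = (SOME V. finite V \<and> interior (convex hull V) \<noteq> {} \<and>
    inner_approx (e k) (convex hull V) (K j))" for k j
  have V: "finite (V k j)" "interior (convex hull V k j) \<noteq> {}" "inner_approx (e k) (convex hull V k j) (K j)"
    if "j < m" for k j
    using someI_ex[OF ex[OF that, of k]] unfolding V_def by blast+
  have hull: "convex hull V k j \<in> conv_bodies" if "j < m" for k j
    using V(1,2)[OF that, of k] by (auto simp: conv_bodies_def finite_imp_compact_convex_hull)
  show ?thesis
  proof (rule LIMSEQ_unique)
    show "(\<lambda>k. vol (\<Sum>j<m. (*\<^sub>R) (x j) ` (convex hull V k j))) \<longlonglongrightarrow> vol (\<Sum>j<m. (*\<^sub>R) (x j) ` K j)"
      using K V hull
      by (intro tendsto_vol_sum_inner_approx[OF e] inner_approx_scaleR conv_bodies_scaleR) auto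
    have "(\<lambda>k. polarization CARD('n) (\<lambda>J. vol (\<Sum>l\<in>J. convex hull V k (i l))))
        \<longlonglongrightarrow> polarization CARD('n) (\<lambda>J. vol (\<Sum>l\<in>J. K (i l)))"
      if "i \<in> {..<CARD('n)} \<rightarrow>\<^sub>E {..<m}" for i
    proof (intro tendsto_polarization tendsto_vol_sum_inner_approx[OF e])
      fix J k l assume "J \<subseteq> {..<CARD('n)}" "l \<in> J"
      then have "i l < m" using that by auto
      then show "inner_approx (e k) (convex hull V k (i l)) (K (i l))" "K (i l) \<in> conv_bodies"
        "convex hull V k (i l) \<in> conv_bodies"
        using V(3) K hull by auto
    qed
    then have "(\<lambda>k. \<Sum>i\<in>{..<CARD('n)} \<rightarrow>\<^sub>E {..<m}.
        polarization CARD('n) (\<lambda>J. vol (\<Sum>l\<in>J. convex hull V k (i l))) * (\<Prod>l<CARD('n). x (i l)))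
      \<longlonglongrightarrow> (\<Sum>i\<in>{..<CARD('n)} \<rightarrow>\<^sub>E {..<m}.
        polarization CARD('n) (\<lambda>J. vol (\<Sum>l\<in>J. K (i l))) * (\<Prod>l<CARD('n). x (i l)))"
      by (intro tendsto_sum tendsto_mult_right)
    moreover have "vol (\<Sum>j<m. (*\<^sub>R) (x j) ` (convex hull V k j)) = (\<Sum>i\<in>{..<CARD('n)} \<rightarrow>\<^sub>E {..<m}.
        polarization CARD('n) (\<lambda>J. vol (\<Sum>l\<in>J. convex hull V k (i l))) * (\<Prod>l<CARD('n). x (i l)))" for k
      using V x by (intro minkowski_expansion_polytopes) auto
    ultimately show "(\<lambda>k. vol (\<Sum>j<m. (*\<^sub>R) (x j) ` (convex hull V k j))) \<longlonglongrightarrow>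
        (\<Sum>i\<in>{..<CARD('n)} \<rightarrow>\<^sub>E {..<m}.
          polarization CARD('n) (\<lambda>J. vol (\<Sum>l\<in>J. K (i l))) * (\<Prod>l<CARD('n). x (i l)))"
      by (simp only:)
  qed
qed

text \<open>Transport along \<open>reindex\<close>; nonempty interior is carried over through
  positivity of the volume.\<close>

theorem minkowski_expansion:
  fixes K :: "nat \<Rightarrow> (real ^ 'n) set"
  assumes K: "\<And>j. j < m \<Longrightarrow> K j \<in> conv_bodies \<and> interior (K j) \<noteq> {}"
    and x: "\<And>j. j < m \<Longrightarrow> 0 \<le> x j"
  shows "vol (\<Sum>j<m. (*\<^sub>R) (x j) ` K j) =
    (\<Sum>i\<in>{..<CARD('n)} \<rightarrow>\<^sub>E {..<m}.
      polarization CARD('n) (\<lambda>J. vol (\<Sum>l\<in>J. K (i l))) * (\<Prod>l<CARD('n). x (i l)))"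
proof -
  have body: "reindex ` K j \<in> conv_bodies" if "j < m" for j
    using K[OF that] by (intro conv_bodies_linear_image linear_reindex) auto
  have int: "interior (reindex ` K j) \<noteq> {}" if "j < m" for j
    using K[OF that] vol_pos[of "K j"] body[OF that]
    by (intro vol_pos_imp_interior) (auto simp: vol_reindex conv_bodies_def)
  have scale: "reindex ` (*\<^sub>R) (x j) ` K j = (*\<^sub>R) (x j) ` reindex ` K j" for j
    by (simp add: image_image linear_scale[OF linear_reindex])
  have "vol (\<Sum>j<m. (*\<^sub>R) (x j) ` K j) = vol (reindex ` (\<Sum>j<m. (*\<^sub>R) (x j) ` K j))"
    using K by (intro vol_reindex[symmetric] conv_bodies_compact conv_bodies_sum conv_bodies_scaleR) auto
  also have "reindex ` (\<Sum>j<m. (*\<^sub>R) (x j) ` K j) = (\<Sum>j<m. (*\<^sub>R) (x j) ` reindex ` K j)"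
    by (simp only: linear_image_set_sum[OF linear_reindex] scale)
  also have "vol \<dots> = (\<Sum>i\<in>{..<CARD('n)} \<rightarrow>\<^sub>E {..<m}.
      polarization CARD('n) (\<lambda>J. vol (\<Sum>l\<in>J. reindex ` K (i l))) * (\<Prod>l<CARD('n). x (i l)))"
    by (rule minkowski_expansion_wellorder[of m "\<lambda>j. reindex ` K j" x, unfolded CARD_wo_copy])
      (simp_all add: body int x)
  also have "\<dots> = (\<Sum>i\<in>{..<CARD('n)} \<rightarrow>\<^sub>E {..<m}.
      polarization CARD('n) (\<lambda>J. vol (\<Sum>l\<in>J. K (i l))) * (\<Prod>l<CARD('n). x (i l)))"
  proof (intro sum.cong refl arg_cong2[where f="(*)"])
    fix i assume i: "i \<in> {..<CARD('n)} \<rightarrow>\<^sub>E {..<m}"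
    have "vol (\<Sum>l\<in>J. reindex ` K (i l)) = vol (\<Sum>l\<in>J. K (i l))" if "J \<subseteq> {..<CARD('n)}" for J
      unfolding linear_image_set_sum[OF linear_reindex, symmetric]
      using i that K by (intro vol_reindex conv_bodies_compact conv_bodies_sum) blast
    then show "polarization CARD('n) (\<lambda>J. vol (\<Sum>l\<in>J. reindex ` K (i l))) =
        polarization CARD('n) (\<lambda>J. vol (\<Sum>l\<in>J. K (i l)))"
      by (simp add: polarization_def)
  qed
  finally show ?thesis .
qed

text \<open>Existence for the definite description: the expansion with as many bodies as dimensions
  has polarized volumes as coefficients.\<close>

lemma mixed_volume_bodies:
  fixes Ks :: "(real ^ 'n) set list"
  assumes Ks: "\<And>j. j < CARD('n) \<Longrightarrow> Ks ! j \<in> conv_bodies \<and> interior (Ks ! j) \<noteq> {}"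
  shows "mixed_volume Ks = polarization CARD('n) (\<lambda>J. vol (\<Sum>l\<in>J. Ks ! l))"
proof (rule mixed_volume_eq_polarization)
  let ?c = "\<lambda>i. polarization CARD('n) (\<lambda>J. vol (\<Sum>l\<in>J. Ks ! i l))"
  show "is_mixed_volume_coeffs Ks ?c"
    unfolding is_mixed_volume_coeffs_def Let_def
  proof (intro conjI ballI allI impI)
    fix i p assume p: "p permutes {..<CARD('n)}"
    have "(\<Sum>l\<in>J. Ks ! (i \<circ> p) l) = (\<Sum>l\<in>p ` J. Ks ! i l)" for J
      using permutes_inj[OF p] by (simp add: sum.reindex inj_on_subset)
    then show "?c (i \<circ> p) = ?c i"
      using polarization_permute[OF p, of "\<lambda>J. vol (\<Sum>l\<in>J. Ks ! i l)"] by simp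
  next
    fix x :: "nat \<Rightarrow> real" assume "\<forall>j<CARD('n). 0 \<le> x j"
    then show "vol (\<Sum>j<CARD('n). (*\<^sub>R) (x j) ` (Ks ! j)) =
        (\<Sum>i\<in>{..<CARD('n)} \<rightarrow>\<^sub>E {..<CARD('n)}. ?c i * (\<Prod>l<CARD('n). x (i l)))"
      using Ks by (intro minkowski_expansion) auto
  qed
  show "Ks ! j \<noteq> {}" if "j < CARD('n)" for j
    using Ks[OF that] by auto
qed

section \<open>The Brunn-Minkowski inequality\<close>

text \<open>This is the case of boxes with side lengths \<open>x\<close> and \<open>y\<close>. After
  division by the right-hand side, AM-GM applied to the ratios \<open>x i / (x i + y i)\<close> and
  \<open>y i / (x i + y i)\<close> gives two means with sum \<open>1\<close>.\<close>

lemma root_prod_superadditive: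
  fixes x y :: "'i \<Rightarrow> real"
  assumes S: "finite S" "S \<noteq> {}" and x: "\<And>i. i \<in> S \<Longrightarrow> 0 < x i" and y: "\<And>i. i \<in> S \<Longrightarrow> 0 < y i"
  shows "root (card S) (\<Prod>i\<in>S. x i) + root (card S) (\<Prod>i\<in>S. y i) \<le> root (card S) (\<Prod>i\<in>S. x i + y i)"
proof -
  let ?n = "card S"
  have n: "0 < ?n" using S by (simp add: card_gt_0_iff)
  have amgm: "root ?n (\<Prod>i\<in>S. z i) \<le> (\<Sum>i\<in>S. z i / ?n)" if "\<And>i. i \<in> S \<Longrightarrow> 0 < z i" for z :: "'i \<Rightarrow> real"
    using arith_geom_mean[OF S, of z] that n
    by (simp add: root_powr_inverse prod_pos less_imp_le)
  have P: "0 < (\<Prod>i\<in>S. x i + y i)"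
    using x y by (intro prod_pos) (simp add: add_pos_pos)
  have quot: "root ?n (\<Prod>i\<in>S. z i) = root ?n (\<Prod>i\<in>S. z i / (x i + y i)) * root ?n (\<Prod>i\<in>S. x i + y i)" for z
    using P by (simp add: real_root_mult[symmetric] prod_dividef)
  have "root ?n (\<Prod>i\<in>S. x i / (x i + y i)) + root ?n (\<Prod>i\<in>S. y i / (x i + y i)) \<le>
      (\<Sum>i\<in>S. x i / (x i + y i) / ?n) + (\<Sum>i\<in>S. y i / (x i + y i) / ?n)"
    using x y by (intro add_mono amgm) (simp_all add: add_pos_pos)
  also have "\<dots> = (\<Sum>i\<in>S. (x i + y i) / (x i + y i) / ?n)"
    by (simp only: sum.distrib[symmetric] add_divide_distrib)
  also have "\<dots> = (\<Sum>i\<in>S. 1 / real ?n)"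
  proof (rule sum.cong[OF refl])
    fix i assume "i \<in> S"
    then have "x i + y i \<noteq> 0" using x[of i] y[of i] by linarith
    then show "(x i + y i) / (x i + y i) / ?n = 1 / real ?n" by simp
  qed
  also have "\<dots> = 1" using n by simp
  finally have le: "root ?n (\<Prod>i\<in>S. x i / (x i + y i)) + root ?n (\<Prod>i\<in>S. y i / (x i + y i)) \<le> 1" .
  have "root ?n (\<Prod>i\<in>S. x i) + root ?n (\<Prod>i\<in>S. y i) =
      (root ?n (\<Prod>i\<in>S. x i / (x i + y i)) + root ?n (\<Prod>i\<in>S. y i / (x i + y i))) * root ?n (\<Prod>i\<in>S. x i + y i)"
    by (simp only: quot[of x] quot[of y] distrib_right)
  also have "\<dots> \<le> 1 * root ?n (\<Prod>i\<in>S. x i + y i)"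
    using le P n by (intro mult_right_mono) (simp_all add: less_imp_le)
  finally show ?thesis by simp
qed

lemma vol_cbox: "cbox a b \<noteq> {} \<Longrightarrow> vol (cbox a b) = (\<Prod>i\<in>Basis. b \<bullet> i - a \<bullet> i)"
  by (simp add: measure_completion content_cbox_if)

lemma cbox_subset_set_plus:
  assumes "cbox a b \<noteq> {}" "cbox c d \<noteq> {}"
  shows "cbox (a + c) (b + d) \<subseteq> cbox a b + cbox c d"
proof
  fix x assume x: "x \<in> cbox (a + c) (b + d)"
  \<comment> \<open>In each coordinate the least value that keeps \<open>y\<close> above
    \<open>a\<close> and \<open>x - y\<close> below \<open>d\<close>.\<close>
  define y where "y = (\<Sum>i\<in>Basis. max (a \<bullet> i) (x \<bullet> i - d \<bullet> i) *\<^sub>R i)"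
  have y: "y \<bullet> i = max (a \<bullet> i) (x \<bullet> i - d \<bullet> i)" if "i \<in> Basis" for i
    using that by (simp add: y_def)
  have "a \<bullet> i \<le> y \<bullet> i \<and> y \<bullet> i \<le> b \<bullet> i \<and> c \<bullet> i \<le> (x - y) \<bullet> i \<and> (x - y) \<bullet> i \<le> d \<bullet> i" if i: "i \<in> Basis" for i
  proof -
    have "a \<bullet> i \<le> b \<bullet> i" "c \<bullet> i \<le> d \<bullet> i"
      using assms i by (simp_all add: box_ne_empty)
    moreover have "a \<bullet> i + c \<bullet> i \<le> x \<bullet> i" "x \<bullet> i \<le> b \<bullet> i + d \<bullet> i"
      using x i by (simp_all add: mem_box inner_add_left)
    ultimately show ?thesis
      unfolding inner_diff_left y[OF i] by linarith
  qed
  then have "y \<in> cbox a b" "x - y \<in> cbox c d"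
    by (simp_all add: mem_box)
  then have "y + (x - y) \<in> cbox a b + cbox c d"
    by (rule set_plus_intro)
  then show "x \<in> cbox a b + cbox c d" by simp
qed

lemma brunn_minkowski_cbox:
  fixes a b c d :: "'a::euclidean_space"
  assumes "box a b \<noteq> {}" "box c d \<noteq> {}"
  shows "(root DIM('a) (vol (cbox a b)) + root DIM('a) (vol (cbox c d))) ^ DIM('a) \<le> vol (cbox a b + cbox c d)"
proof -
  have ab: "a \<bullet> i < b \<bullet> i" and cd: "c \<bullet> i < d \<bullet> i" if "i \<in> Basis" for i
    using assms that by (auto simp: box_ne_empty)
  have ne: "cbox a b \<noteq> {}" "cbox c d \<noteq> {}" "cbox (a + c) (b + d) \<noteq> {}"
    using ab cd by (simp_all add: box_ne_empty inner_add_left add_mono less_imp_le)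
  have "root DIM('a) (vol (cbox a b)) + root DIM('a) (vol (cbox c d)) \<le>
      root DIM('a) (\<Prod>i\<in>Basis. (b \<bullet> i - a \<bullet> i) + (d \<bullet> i - c \<bullet> i))"
    unfolding vol_cbox[OF ne(1)] vol_cbox[OF ne(2)]
    using ab cd by (intro root_prod_superadditive) auto
  also have "(\<Prod>i\<in>Basis. (b \<bullet> i - a \<bullet> i) + (d \<bullet> i - c \<bullet> i)) = vol (cbox (a + c) (b + d))"
    unfolding vol_cbox[OF ne(3)] by (simp add: inner_add_left algebra_simps)
  finally have le: "root DIM('a) (vol (cbox a b)) + root DIM('a) (vol (cbox c d)) \<le> root DIM('a) (vol (cbox (a + c) (b + d)))" .
  have "(root DIM('a) (vol (cbox a b)) + root DIM('a) (vol (cbox c d))) ^ DIM('a) \<le>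
      root DIM('a) (vol (cbox (a + c) (b + d))) ^ DIM('a)"
    by (intro power_mono[OF le] add_nonneg_nonneg) simp_all
  also have "\<dots> = vol (cbox (a + c) (b + d))"
    by simp
  also have "\<dots> \<le> vol (cbox a b + cbox c d)"
    by (intro vol_mono cbox_subset_set_plus compact_cbox compact_set_plus ne)
  finally show ?thesis .
qed

section \<open>Finite families of boxes and the Hadwiger-Ohmann induction\<close>

text \<open>Index set and map are separate so that a cut can discard degenerate pieces while the
  others keep their index.\<close>

definition box_family :: "nat set \<Rightarrow> (nat \<Rightarrow> 'a::euclidean_space set) \<Rightarrow> bool" where
  "box_family I K \<longleftrightarrow> finite I \<and> (\<forall>i\<in>I. interior (K i) \<noteq> {} \<and> (\<exists>a b. K i = cbox a b)) \<and>
    (\<forall>i\<in>I. \<forall>j\<in>I. i \<noteq> j \<longrightarrow> interior (K i) \<inter> interior (K j) = {})"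

lemma box_familyD:
  assumes "box_family I K"
  shows "finite I" "i \<in> I \<Longrightarrow> interior (K i) \<noteq> {}" "i \<in> I \<Longrightarrow> \<exists>a b. K i = cbox a b"
    "i \<in> I \<Longrightarrow> j \<in> I \<Longrightarrow> i \<noteq> j \<Longrightarrow> interior (K i) \<inter> interior (K j) = {}"
    "i \<in> I \<Longrightarrow> K i \<in> conv_bodies" "compact (\<Union>i\<in>I. K i)" "i \<in> I \<Longrightarrow> 0 < vol (K i)"
proof -
  show fin: "finite I" and 1: "i \<in> I \<Longrightarrow> interior (K i) \<noteq> {}" and box: "i \<in> I \<Longrightarrow> \<exists>a b. K i = cbox a b"
    and "i \<in> I \<Longrightarrow> j \<in> I \<Longrightarrow> i \<noteq> j \<Longrightarrow> interior (K i) \<inter> interior (K j) = {}" for i j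
    using assms by (simp_all add: box_family_def)
  show body: "K i \<in> conv_bodies" if "i \<in> I" for i
  proof -
    have "K i \<noteq> {}" using 1[OF that] by auto
    then show ?thesis using box[OF that] by (auto simp: conv_bodies_def)
  qed
  show "compact (\<Union>i\<in>I. K i)"
    using fin body by (intro compact_UN) (auto simp: conv_bodies_compact)
  show "i \<in> I \<Longrightarrow> 0 < vol (K i)"
    by (intro vol_pos body 1)
qed

text \<open>A piece without interior points is a degenerate box of volume \<open>0\<close>, so
  discarding it preserves the total. \<open>H\<close> stands for either of two closed
  half-spaces.\<close>

lemma box_family_cut:
  assumes fam: "box_family I K" and H: "\<And>a b. \<exists>c d. cbox a b \<inter> H = cbox c d"
  shows "box_family {i \<in> I. interior (K i \<inter> H) \<noteq> {}} (\<lambda>i. K i \<inter> H)"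
    and "(\<Sum>i | i \<in> I \<and> interior (K i \<inter> H) \<noteq> {}. vol (K i \<inter> H)) = (\<Sum>i\<in>I. vol (K i \<inter> H))"
proof -
  have box: "\<exists>a b. K i \<inter> H = cbox a b" if "i \<in> I" for i
    using box_familyD(3)[OF fam that] H by metis
  show "box_family {i \<in> I. interior (K i \<inter> H) \<noteq> {}} (\<lambda>i. K i \<inter> H)"
    unfolding box_family_def
  proof (intro conjI ballI impI)
    fix i j assume "i \<in> {i \<in> I. interior (K i \<inter> H) \<noteq> {}}" "j \<in> {i \<in> I. interior (K i \<inter> H) \<noteq> {}}" "i \<noteq> j"
    then have "interior (K i) \<inter> interior (K j) = {}"
      using box_familyD(4)[OF fam] by simp
    then show "interior (K i \<inter> H) \<inter> interior (K j \<inter> H) = {}"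
      by auto
  qed (use box box_familyD(1)[OF fam] in auto)
  have "vol (K i \<inter> H) = 0" if i: "i \<in> I" and emp: "interior (K i \<inter> H) = {}" for i
  proof -
    obtain a b where "K i \<inter> H = cbox a b" using box[OF i] by blast
    then have "convex (K i \<inter> H)" by simp
    from negligible_convex_interior[OF this] emp have "negligible (K i \<inter> H)" by simp
    then show ?thesis by (rule negligible_imp_measure0)
  qed
  then show "(\<Sum>i | i \<in> I \<and> interior (K i \<inter> H) \<noteq> {}. vol (K i \<inter> H)) = (\<Sum>i\<in>I. vol (K i \<inter> H))"
    using box_familyD(1)[OF fam] by (intro sum.mono_neutral_left) auto
qed

lemma halfspace_cut:
  fixes e :: "'a::euclidean_space"
  assumes "e \<in> Basis"
  shows "\<exists>c d. cbox a b \<inter> {x. x \<bullet> e \<le> t} = cbox c d" "\<exists>c d. cbox a b \<inter> {x. t \<le> x \<bullet> e} = cbox c d"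
  using interval_split[OF assms] by blast+

lemma vol_cbox_split:
  assumes "e \<in> Basis"
  shows "vol (cbox a b) = vol (cbox a b \<inter> {x. x \<bullet> e \<le> t}) + vol (cbox a b \<inter> {x. t \<le> x \<bullet> e})"
  using content_split[OF assms, of a b t] interval_split[OF assms, of a b t]
  by (simp add: measure_completion)

lemma box_family_split:
  assumes "box_family I K" "e \<in> Basis"
  shows "(\<Sum>i\<in>I. vol (K i)) = (\<Sum>i\<in>I. vol (K i \<inter> {x. x \<bullet> e \<le> t})) + (\<Sum>i\<in>I. vol (K i \<inter> {x. t \<le> x \<bullet> e}))"
  unfolding sum.distrib[symmetric]
proof (rule sum.cong[OF refl])
  fix i assume "i \<in> I"
  then obtain a b where "K i = cbox a b" using box_familyD(3)[OF assms(1)] by blast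
  then show "vol (K i) = vol (K i \<inter> {x. x \<bullet> e \<le> t}) + vol (K i \<inter> {x. t \<le> x \<bullet> e})"
    using vol_cbox_split[OF assms(2)] by simp
qed

lemma continuous_on_vol_cbox_cut:
  fixes e :: "'a::euclidean_space"
  assumes e: "e \<in> Basis" and ne: "cbox a b \<noteq> {}"
  shows "continuous_on S (\<lambda>t. vol (cbox a b \<inter> {x. x \<bullet> e \<le> t}))"
proof -
  let ?b = "\<lambda>t. \<Sum>i\<in>Basis. (if i = e then min (b \<bullet> e) t else b \<bullet> i) *\<^sub>R i"
  let ?c = "\<Prod>i\<in>Basis - {e}. b \<bullet> i - a \<bullet> i"
  have ab: "a \<bullet> i \<le> b \<bullet> i" if "i \<in> Basis" for i
    using ne that by (auto simp: box_ne_empty)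
  \<comment> \<open>\<open>max 0\<close> covers the levels below the box, where the cut is
    empty.\<close>
  have eq: "vol (cbox a b \<inter> {x. x \<bullet> e \<le> t}) = max 0 (min (b \<bullet> e) t - a \<bullet> e) * ?c" for t
  proof (cases "a \<bullet> e \<le> t")
    case True
    then have ne': "cbox a (?b t) \<noteq> {}"
      using ab e by (auto simp: box_ne_empty)
    have "vol (cbox a (?b t)) = (\<Prod>i\<in>Basis. (if i = e then min (b \<bullet> e) t else b \<bullet> i) - a \<bullet> i)"
      unfolding vol_cbox[OF ne'] by (intro prod.cong) auto
    also have "\<dots> = (min (b \<bullet> e) t - a \<bullet> e) * ?c"
      using e by (subst prod.remove[of _ e]) (auto intro!: prod.cong)
    finally show ?thesis
      unfolding interval_split(1)[OF e] using True ab[OF e] by simp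
  next
    case False
    then have "cbox a b \<inter> {x. x \<bullet> e \<le> t} = {}"
      using e by (force simp: mem_box)
    then show ?thesis using False by simp
  qed
  show ?thesis
    unfolding eq by (intro continuous_intros)
qed

lemma exists_cut:
  fixes e :: "'a::euclidean_space"
  assumes fam: "box_family J L" and e: "e \<in> Basis" and s: "0 \<le> s" "s \<le> (\<Sum>j\<in>J. vol (L j))"
  shows "\<exists>t. (\<Sum>j\<in>J. vol (L j \<inter> {x. x \<bullet> e \<le> t})) = s"
proof -
  obtain R where R: "\<And>x. x \<in> (\<Union>j\<in>J. L j) \<Longrightarrow> norm x \<le> R"
    using compact_imp_bounded[OF box_familyD(6)[OF fam]] unfolding bounded_iff by blast
  have bnd: "\<bar>x \<bullet> e\<bar> \<le> R" if "x \<in> L j" "j \<in> J" for x j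
    using R[of x] that Basis_le_norm[OF e, of x] by force
  \<comment> \<open>The \<open>+ 1\<close> makes the cut at the lower end empty and not merely a
    face.\<close>
  let ?R = "\<bar>R\<bar> + 1"
  have "L j \<inter> {x. x \<bullet> e \<le> - ?R} = {}" "L j \<inter> {x. x \<bullet> e \<le> ?R} = L j" if "j \<in> J" for j
    using bnd[OF _ that] by fastforce+
  then have ends: "(\<Sum>j\<in>J. vol (L j \<inter> {x. x \<bullet> e \<le> - ?R})) = 0"
    "(\<Sum>j\<in>J. vol (L j \<inter> {x. x \<bullet> e \<le> ?R})) = (\<Sum>j\<in>J. vol (L j))"
    by simp_all
  have "continuous_on {- ?R..?R} (\<lambda>t. \<Sum>j\<in>J. vol (L j \<inter> {x. x \<bullet> e \<le> t}))"
  proof (rule continuous_on_sum)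
    fix j assume j: "j \<in> J"
    obtain a b where "L j = cbox a b" using box_familyD(3)[OF fam j] by blast
    moreover have "L j \<noteq> {}" using box_familyD(2)[OF fam j] by auto
    ultimately show "continuous_on {- ?R..?R} (\<lambda>t. vol (L j \<inter> {x. x \<bullet> e \<le> t}))"
      using continuous_on_vol_cbox_cut[OF e] by simp
  qed
  from IVT'[OF _ _ _ this, of s] show ?thesis
    using ends s by auto
qed

text \<open>Disjoint nonempty open boxes have disjoint projections to some axis; \<open>p\<close>
  and \<open>q\<close> are \<open>i\<close> and \<open>j\<close> sorted along that axis.\<close>

lemma box_family_separate:
  fixes K :: "nat \<Rightarrow> 'a::euclidean_space set"
  assumes fam: "box_family I K" and ij: "i \<in> I" "j \<in> I" "i \<noteq> j"
  shows "\<exists>p\<in>I. \<exists>q\<in>I. \<exists>e\<in>Basis. \<exists>t. p \<noteq> q \<and> K p \<subseteq> {x. x \<bullet> e \<le> t} \<and> K q \<subseteq> {x. t \<le> x \<bullet> e}"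
proof -
  obtain a b c d where K: "K i = cbox a b" "K j = cbox c d"
    using box_familyD(3)[OF fam ij(1)] box_familyD(3)[OF fam ij(2)] by blast
  have ne: "box a b \<noteq> {}" "box c d \<noteq> {}"
    using box_familyD(2)[OF fam ij(1)] box_familyD(2)[OF fam ij(2)] by (simp_all add: K)
  have "box a b \<inter> box c d = {}"
    using box_familyD(4)[OF fam ij] by (simp add: K)
  then obtain e where e: "e \<in> Basis"
    and e_or: "b \<bullet> e \<le> a \<bullet> e \<or> d \<bullet> e \<le> c \<bullet> e \<or> b \<bullet> e \<le> c \<bullet> e \<or> d \<bullet> e \<le> a \<bullet> e"
    unfolding disjoint_interval(4) by (rule bexE)
  have "a \<bullet> e < b \<bullet> e" "c \<bullet> e < d \<bullet> e"
    using ne e by (simp_all add: box_ne_empty)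
  have box_e: "u \<bullet> e \<le> x \<bullet> e \<and> x \<bullet> e \<le> v \<bullet> e" if "x \<in> cbox u v" for x u v
    using that e by (simp add: mem_box)
  from e_or \<open>a \<bullet> e < b \<bullet> e\<close> \<open>c \<bullet> e < d \<bullet> e\<close> have "b \<bullet> e \<le> c \<bullet> e \<or> d \<bullet> e \<le> a \<bullet> e" by linarith
  then show ?thesis
  proof
    assume "b \<bullet> e \<le> c \<bullet> e"
    then have "K i \<subseteq> {x. x \<bullet> e \<le> c \<bullet> e}" "K j \<subseteq> {x. c \<bullet> e \<le> x \<bullet> e}"
      using box_e[of _ a b] box_e[of _ c d] unfolding K by force+
    then show ?thesis using ij e
      by (intro bexI[of _ i] bexI[of _ j] bexI[of _ e] exI[of _ "c \<bullet> e"] conjI)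
  next
    assume "d \<bullet> e \<le> a \<bullet> e"
    then have "K j \<subseteq> {x. x \<bullet> e \<le> a \<bullet> e}" "K i \<subseteq> {x. a \<bullet> e \<le> x \<bullet> e}"
      using box_e[of _ a b] box_e[of _ c d] unfolding K by force+
    then show ?thesis using ij e
      by (intro bexI[of _ j] bexI[of _ i] bexI[of _ e] exI[of _ "a \<bullet> e"] conjI) simp_all
  qed
qed

text \<open>The volume of each union is replaced by the sum over its boxes, which is additive under
  cuts. The \<open>n\<close>-th power makes the left side homogeneous of degree one in the volumes,
  so that common factors of the two halves come out.\<close>

definition brunn_minkowski_on :: "nat set \<Rightarrow> (nat \<Rightarrow> 'a::euclidean_space set) \<Rightarrow> nat set \<Rightarrow> (nat \<Rightarrow> 'a set) \<Rightarrow> bool" where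
  "brunn_minkowski_on I K J L \<longleftrightarrow>
    (root DIM('a) (\<Sum>i\<in>I. vol (K i)) + root DIM('a) (\<Sum>j\<in>J. vol (L j))) ^ DIM('a)
      \<le> vol ((\<Union>i\<in>I. K i) + (\<Union>j\<in>J. L j))"

lemma brunn_minkowski_on_commute: "brunn_minkowski_on I K J L \<longleftrightarrow> brunn_minkowski_on J L I K"
  by (simp add: brunn_minkowski_on_def add.commute)

text \<open>The Hadwiger-Ohmann step: a coordinate hyperplane separating two boxes of the first family and
  a parallel one that cuts the second family in the same ratio reduce the claim to both halves.\<close>

lemma brunn_minkowski_step:
  fixes K L :: "nat \<Rightarrow> 'a::euclidean_space set"
  assumes K: "box_family I K" and L: "box_family J L" "J \<noteq> {}" and ij: "i \<in> I" "j \<in> I" "i \<noteq> j"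
    and IH: "\<And>I' K' J' L'. box_family I' K' \<Longrightarrow> box_family J' L' \<Longrightarrow> I' \<noteq> {} \<Longrightarrow> J' \<noteq> {} \<Longrightarrow>
      card I' + card J' < card I + card J \<Longrightarrow> brunn_minkowski_on I' K' J' (L' :: nat \<Rightarrow> 'a set)"
  shows "brunn_minkowski_on I K J L"
proof -
  let ?n = "DIM('a)"
  obtain p q e t where pq: "p \<in> I" "q \<in> I" "p \<noteq> q" and e: "e \<in> Basis"
    and sep: "K p \<subseteq> {x. x \<bullet> e \<le> t}" "K q \<subseteq> {x. t \<le> x \<bullet> e}"
    using box_family_separate[OF K ij] by blast
  define Hl where "Hl s = {x. x \<bullet> e \<le> s}" for s
  define Hr where "Hr s = {x. s \<le> x \<bullet> e}" for s
  define cut where "cut M F H = {i \<in> M. interior (F i \<inter> H) \<noteq> {}}" for M and F :: "nat \<Rightarrow> 'a set" and H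
  define W where "W M F = (\<Sum>i\<in>M. vol (F i))" for M and F :: "nat \<Rightarrow> 'a set"
  define U where "U M F = (\<Union>i\<in>M. F i)" for M and F :: "nat \<Rightarrow> 'a set"
  have plane: "interior {x. x \<bullet> e = s} = {}" for s
    using interior_hyperplane[of e s] nonzero_Basis[OF e] by (simp add: inner_commute)
  have cut: "box_family (cut M F (Hl s)) (\<lambda>i. F i \<inter> Hl s)" "box_family (cut M F (Hr s)) (\<lambda>i. F i \<inter> Hr s)"
    "W M F = W (cut M F (Hl s)) (\<lambda>i. F i \<inter> Hl s) + W (cut M F (Hr s)) (\<lambda>i. F i \<inter> Hr s)"
    "W (cut M F (Hl s)) (\<lambda>i. F i \<inter> Hl s) = (\<Sum>i\<in>M. vol (F i \<inter> Hl s))"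
    if "box_family M F" for M F s
    using box_family_cut[OF that halfspace_cut(1)[OF e]] box_family_cut[OF that halfspace_cut(2)[OF e]]
      box_family_split[OF that e]
    unfolding Hl_def Hr_def cut_def W_def by (simp_all)
  have W_pos: "0 < W M F" if "box_family M F" "M \<noteq> {}" for M F
    unfolding W_def using box_familyD(1,7)[OF that(1)] that(2) by (intro sum_pos)
  have ne_if_W: "M \<noteq> {}" if "0 < W M F" for M F
    using that by (auto simp: W_def)
  define Il where "Il = cut I K (Hl t)"
  define Ir where "Ir = cut I K (Hr t)"
  have "K q \<inter> Hl t \<subseteq> {x. x \<bullet> e = t}" "K p \<inter> Hr t \<subseteq> {x. x \<bullet> e = t}"
    using sep by (auto simp: Hl_def Hr_def)
  from this[THEN interior_mono] have "interior (K q \<inter> Hl t) = {}" "interior (K p \<inter> Hr t) = {}"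
    unfolding plane by simp_all
  moreover have "K p \<inter> Hl t = K p" "K q \<inter> Hr t = K q"
    using sep by (auto simp: Hl_def Hr_def)
  \<comment> \<open>\<open>p\<close> disappears on the right and \<open>q\<close> on the left, so
    each half of the first family is strictly smaller and the induction hypothesis applies.\<close>
  ultimately have mem: "p \<in> Il" "q \<notin> Il" "q \<in> Ir" "p \<notin> Ir"
    using pq box_familyD(2)[OF K] by (simp_all add: Il_def Ir_def cut_def del: interior_Int)
  have card_I: "card Il < card I" "card Ir < card I"
    using mem pq box_familyD(1)[OF K] by (auto simp: Il_def Ir_def cut_def intro!: psubset_card_mono)
  let ?al = "W Il (\<lambda>i. K i \<inter> Hl t)" and ?ar = "W Ir (\<lambda>i. K i \<inter> Hr t)"
  have al: "0 < ?al" and ar: "0 < ?ar"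
    using cut(1,2)[OF K, of t] mem by (auto simp: Il_def[symmetric] Ir_def[symmetric] intro!: W_pos)
  have a: "W I K = ?al + ?ar"
    unfolding Il_def Ir_def by (rule cut(3)[OF K])
  define \<theta> where "\<theta> = ?al / W I K"
  have \<theta>: "0 < \<theta>" "\<theta> < 1" "?al = \<theta> * W I K" "?ar = (1 - \<theta>) * W I K"
    using al ar unfolding \<theta>_def a by (simp_all add: field_simps)
  have b: "0 < W J L" by (rule W_pos[OF L])
  have "0 \<le> \<theta> * W J L" "\<theta> * W J L \<le> (\<Sum>j\<in>J. vol (L j))"
    using \<theta>(1,2) b unfolding W_def[symmetric] by (simp_all add: mult_left_le_one_le)
  from exists_cut[OF L(1) e this] obtain s where s: "(\<Sum>j\<in>J. vol (L j \<inter> Hl s)) = \<theta> * W J L"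
    unfolding Hl_def by blast
  define Jl where "Jl = cut J L (Hl s)"
  define Jr where "Jr = cut J L (Hr s)"
  let ?bl = "W Jl (\<lambda>i. L i \<inter> Hl s)" and ?br = "W Jr (\<lambda>i. L i \<inter> Hr s)"
  have bl: "?bl = \<theta> * W J L"
    unfolding Jl_def cut(4)[OF L(1)] by (rule s)
  have br: "?br = (1 - \<theta>) * W J L"
    using cut(3)[OF L(1), of s] bl unfolding Jl_def Jr_def by (simp add: left_diff_distrib)
  have ne_J: "Jl \<noteq> {}" "Jr \<noteq> {}"
    by (rule ne_if_W[of _ "\<lambda>i. L i \<inter> Hl s"], simp add: bl b \<theta>, rule ne_if_W[of _ "\<lambda>i. L i \<inter> Hr s"], simp add: br b \<theta>)
  have card_J: "card Jl \<le> card J" "card Jr \<le> card J"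
    using box_familyD(1)[OF L(1)] by (auto simp: Jl_def Jr_def cut_def intro!: card_mono)
  define Sl where "Sl = U Il (\<lambda>i. K i \<inter> Hl t) + U Jl (\<lambda>i. L i \<inter> Hl s)"
  define Sr where "Sr = U Ir (\<lambda>i. K i \<inter> Hr t) + U Jr (\<lambda>i. L i \<inter> Hr s)"
  have scale: "(root ?n (c * x) + root ?n (c * y)) ^ ?n = c * (root ?n x + root ?n y) ^ ?n" if "0 \<le> c" for c x y
    using that by (simp add: real_root_mult distrib_left[symmetric] power_mult_distrib)
  have "brunn_minkowski_on Il (\<lambda>i. K i \<inter> Hl t) Jl (\<lambda>i. L i \<inter> Hl s)"
    using mem ne_J card_I card_J cut(1)[OF K, of t] cut(1)[OF L(1), of s]
    by (intro IH) (auto simp: Il_def Jl_def)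
  then have left: "\<theta> * (root ?n (W I K) + root ?n (W J L)) ^ ?n \<le> vol Sl"
    unfolding brunn_minkowski_on_def W_def[symmetric] U_def[symmetric] Sl_def[symmetric] \<theta>(3) bl
    using \<theta> by (simp add: scale)
  have "brunn_minkowski_on Ir (\<lambda>i. K i \<inter> Hr t) Jr (\<lambda>i. L i \<inter> Hr s)"
    using mem ne_J card_I card_J cut(2)[OF K, of t] cut(2)[OF L(1), of s]
    by (intro IH) (auto simp: Ir_def Jr_def)
  then have right: "(1 - \<theta>) * (root ?n (W I K) + root ?n (W J L)) ^ ?n \<le> vol Sr"
    unfolding brunn_minkowski_on_def W_def[symmetric] U_def[symmetric] Sr_def[symmetric] \<theta>(4) br
    using \<theta> by (simp add: scale)
  have comp: "compact Sl" "compact Sr" "compact (U I K + U J L)"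
    unfolding Sl_def Sr_def Il_def Ir_def Jl_def Jr_def U_def
    by (intro compact_set_plus box_familyD(6) cut K L)+
  \<comment> \<open>The two half sums lie on opposite sides of the hyperplane at level
    \<open>t + s\<close>, so their volumes add up.\<close>
  have "Sl \<inter> Sr \<subseteq> {x. e \<bullet> x = t + s}"
  proof
    fix x assume "x \<in> Sl \<inter> Sr"
    then have "x \<in> Sl" "x \<in> Sr" by simp_all
    from this(1) have "x \<bullet> e \<le> t + s"
      unfolding Sl_def U_def Hl_def by (elim set_plus_elim) (auto simp: inner_add_left)
    moreover from \<open>x \<in> Sr\<close> have "t + s \<le> x \<bullet> e"
      unfolding Sr_def U_def Hr_def by (elim set_plus_elim) (auto simp: inner_add_left)
    ultimately show "x \<in> {x. e \<bullet> x = t + s}" by (simp add: inner_commute)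
  qed
  moreover have "negligible {x. e \<bullet> x = t + s}"
    using nonzero_Basis[OF e] by (intro negligible_hyperplane) simp
  ultimately have "negligible (Sl \<inter> Sr)"
    by (rule negligible_subset[rotated])
  then have "vol Sl + vol Sr = vol (Sl \<union> Sr)"
    using measure_Un3[OF lmeasurable_compact[OF comp(1)] lmeasurable_compact[OF comp(2)]]
    by (simp add: negligible_imp_measure0)
  also have "\<dots> \<le> vol (U I K + U J L)"
  proof (rule vol_mono[OF _ compact_Un[OF comp(1,2)] comp(3)])
    show "Sl \<union> Sr \<subseteq> U I K + U J L"
      unfolding Sl_def Sr_def Il_def Ir_def Jl_def Jr_def U_def cut_def
      by (intro Un_least set_plus_mono2) auto
  qed
  finally have "\<theta> * (root ?n (W I K) + root ?n (W J L)) ^ ?n + (1 - \<theta>) * (root ?n (W I K) + root ?n (W J L)) ^ ?n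
      \<le> vol (U I K + U J L)"
    using left right by linarith
  then show ?thesis
    unfolding brunn_minkowski_on_def W_def[symmetric] U_def[symmetric] by (simp add: left_diff_distrib)
qed

text \<open>Induction on the total number of boxes; the inequality is symmetric, so a second box in
  either family allows a cut.\<close>

lemma brunn_minkowski_boxes:
  fixes K L :: "nat \<Rightarrow> 'a::euclidean_space set"
  assumes "box_family I K" "box_family J L" "I \<noteq> {}" "J \<noteq> {}"
  shows "brunn_minkowski_on I K J L"
  using assms
proof (induction "card I + card J" arbitrary: I K J L rule: less_induct)
  case less
  have two: "\<exists>i j. i \<in> M \<and> j \<in> M \<and> i \<noteq> j" if "M \<noteq> {}" "\<nexists>i. M = {i}" for M :: "nat set"
    using that by blast
  consider i j where "I = {i}" "J = {j}" | i j where "i \<in> I" "j \<in> I" "i \<noteq> j" | i j where "i \<in> J" "j \<in> J" "i \<noteq> j"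
    using two[OF less.prems(3)] two[OF less.prems(4)] by blast
  then show ?case
  proof cases
    case (1 i j)
    obtain a b c d where ab: "K i = cbox a b" "L j = cbox c d"
      using box_familyD(3)[OF less.prems(1), of i] box_familyD(3)[OF less.prems(2), of j] 1 by auto
    then have "box a b \<noteq> {}" "box c d \<noteq> {}"
      using box_familyD(2)[OF less.prems(1), of i] box_familyD(2)[OF less.prems(2), of j] 1 by auto
    from brunn_minkowski_cbox[OF this] show ?thesis
      by (simp add: brunn_minkowski_on_def 1 ab)
  next
    case (2 i j)
    show ?thesis
      by (rule brunn_minkowski_step[OF less.prems(1,2,4) 2]) (rule less.hyps)
  next
    case (3 i j)
    show ?thesis
      unfolding brunn_minkowski_on_commute[of I K J L]
      by (rule brunn_minkowski_step[OF less.prems(2,1,3) 3]) (rule less.hyps, simp_all add: add.commute)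
  qed
qed

text \<open>The interior is a countable union of non-overlapping boxes, finitely many of which carry
  all but \<eta> of the volume; the frontier of \<open>K\<close> is negligible.\<close>

lemma box_family_inner_approx:
  fixes K :: "'a::euclidean_space set"
  assumes K: "K \<in> conv_bodies" "interior K \<noteq> {}" and \<eta>: "0 < \<eta>"
  shows "\<exists>I F. box_family I F \<and> (\<Union>i\<in>I. F i) \<subseteq> K \<and> vol K - \<eta> < (\<Sum>i\<in>I. vol (F i))"
proof -
  let ?S = "interior K"
  have bnd: "bounded ?S"
    using K(1) by (meson bounded_interior compact_imp_bounded conv_bodies_compact)
  obtain a where a: "?S \<subseteq> box (- a) a"
    by (rule bounded_subset_box_symmetric[OF bnd])
  have box_ne: "box (- a) a \<noteq> {}" using a K(2) by auto
  have sub: "?S \<subseteq> cbox (- a) a" using a box_subset_cbox by (rule order_trans)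
  \<comment> \<open>Each box of the covering lies in the gauge set of one of its points in the
    interior, hence inside \<open>interior K\<close>. The unit ball is the default that makes
    \<open>g\<close> a gauge elsewhere.\<close>
  define g where "g x = (if x \<in> ?S then ?S else ball x 1)" for x
  have "gauge g" by (auto simp: gauge_def g_def)
  have "\<exists>\<D>. countable \<D> \<and> (\<forall>C\<in>\<D>. interior C \<noteq> {} \<and> (\<exists>c d. C = cbox c d)) \<and>
    pairwise (\<lambda>A B. interior A \<inter> interior B = {}) \<D> \<and> (\<forall>C\<in>\<D>. \<exists>x \<in> ?S \<inter> C. C \<subseteq> g x) \<and> ?S \<subseteq> \<Union>\<D>"
  proof (rule covering_lemma[OF sub box_ne \<open>gauge g\<close>])
    fix \<D> assume "countable \<D>" "\<And>C. C \<in> \<D> \<Longrightarrow> interior C \<noteq> {} \<and> (\<exists>c d. C = cbox c d)"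
      "pairwise (\<lambda>A B. interior A \<inter> interior B = {}) \<D>" "\<And>C. C \<in> \<D> \<Longrightarrow> \<exists>x \<in> ?S \<inter> C. C \<subseteq> g x"
      "?S \<subseteq> \<Union>\<D>"
    then show ?thesis by (intro exI[of _ \<D>] conjI ballI) simp_all
  qed
  then obtain \<D> where D: "countable \<D>" "\<And>C. C \<in> \<D> \<Longrightarrow> interior C \<noteq> {} \<and> (\<exists>c d. C = cbox c d)"
      "pairwise (\<lambda>A B. interior A \<inter> interior B = {}) \<D>" "\<And>C. C \<in> \<D> \<Longrightarrow> \<exists>x \<in> ?S \<inter> C. C \<subseteq> g x"
      "?S \<subseteq> \<Union>\<D>"
    by (elim exE conjE) simp
  have sub_S: "C \<subseteq> ?S" if C: "C \<in> \<D>" for C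
  proof -
    obtain x where "x \<in> ?S" "C \<subseteq> g x" using D(4)[OF C] by blast
    then show ?thesis by (simp only: g_def if_True)
  qed
  then have U: "\<Union>\<D> = ?S" using D(5) by (intro equalityI Union_least)
  have meas: "d \<in> lmeasurable" if "d \<in> \<D>" for d
    using D(2)[OF that] lmeasurable_cbox by blast
  have S_meas: "?S \<in> lmeasurable" by (rule lmeasurable_open[OF bnd open_interior])
  have "vol (\<Union>D') \<le> vol ?S" if "D' \<subseteq> \<D>" "finite D'" for D'
  proof (rule measure_mono_fmeasurable[OF _ _ S_meas])
    show "\<Union>D' \<subseteq> ?S" unfolding U[symmetric] using that(1) by (rule Union_mono)
    show "\<Union>D' \<in> sets lebesgue"
      using that(2) by (rule sets.finite_Union) (use that(1) meas in blast)
  qed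
  from measure_countable_Union_approachable[OF D(1) \<eta> meas this]
  obtain \<F> where F: "\<F> \<subseteq> \<D>" "finite \<F>" "vol (\<Union>\<D>) - \<eta> < vol (\<Union>\<F>)" .
  obtain h where h: "bij_betw h {..<card \<F>} \<F>"
    using ex_bij_betw_nat_finite[OF F(2)] by (auto simp: atLeast0LessThan)
  have mem: "h i \<in> \<D>" if "i < card \<F>" for i
    using h F(1) that by (auto simp: bij_betw_def)
  have "box_family {..<card \<F>} h"
    unfolding box_family_def
  proof (intro conjI ballI impI)
    fix i j assume "i \<in> {..<card \<F>}" "j \<in> {..<card \<F>}" "i \<noteq> j"
    then have "h i \<in> \<D>" "h j \<in> \<D>" "h i \<noteq> h j"
      using mem h by (auto simp: bij_betw_def inj_on_def)
    then show "interior (h i) \<inter> interior (h j) = {}"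
      using D(3) by (simp add: pairwise_def)
  qed (use mem D(2) in blast)+
  moreover have "(\<Union>i\<in>{..<card \<F>}. h i) \<subseteq> K"
    by (rule UN_least) (rule order_trans[OF sub_S interior_subset], rule mem, simp)
  moreover have "vol K - \<eta> < (\<Sum>i<card \<F>. vol (h i))"
  proof -
    have "vol K - \<eta> = vol (\<Union>\<D>) - \<eta>"
      unfolding U using K(1)
      by (subst measure_interior) (auto simp: conv_bodies_def compact_imp_bounded negligible_convex_frontier)
    also have "\<dots> < vol (\<Union>\<F>)" by (rule F(3))
    also have "\<dots> \<le> (\<Sum>S\<in>\<F>. vol S)"
      using F(2) by (rule measure_Union_le) (use F(1) meas in blast)
    also have "\<dots> = (\<Sum>i<card \<F>. vol (h i))"
      by (rule sum.reindex_bij_betw[OF h, symmetric])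
    finally show ?thesis .
  qed
  ultimately show ?thesis
    by (intro exI[of _ "{..<card \<F>}"] exI[of _ h] conjI)
qed

theorem brunn_minkowski:
  fixes K L :: "'a::euclidean_space set"
  assumes K: "K \<in> conv_bodies" "interior K \<noteq> {}" and L: "L \<in> conv_bodies" "interior L \<noteq> {}"
  shows "(root DIM('a) (vol K) + root DIM('a) (vol L)) ^ DIM('a) \<le> vol (K + L)"
proof (rule tendsto_upperbound)
  let ?n = "DIM('a)"
  let ?f = "\<lambda>\<eta>. (root ?n (vol K - \<eta>) + root ?n (vol L - \<eta>)) ^ ?n"
  have "(?f \<longlongrightarrow> (root ?n (vol K - 0) + root ?n (vol L - 0)) ^ ?n) (at_right 0)"
    by (intro tendsto_intros)
  then show "(?f \<longlongrightarrow> (root ?n (vol K) + root ?n (vol L)) ^ ?n) (at_right 0)" by simp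
  \<comment> \<open>For \<eta> below both volumes the totals of the box families stay positive, so
    neither family is empty.\<close>
  have "\<forall>\<^sub>F \<eta> in at_right 0. 0 < \<eta> \<and> \<eta> < min (vol K) (vol L)"
    using vol_pos[OF K] vol_pos[OF L] by (intro eventually_at_rightI[of 0 "min (vol K) (vol L)"]) auto
  then show "\<forall>\<^sub>F \<eta> in at_right 0. ?f \<eta> \<le> vol (K + L)"
  proof eventually_elim
    case (elim \<eta>)
    then have pos: "0 < vol K - \<eta>" "0 < vol L - \<eta>" and \<eta>: "0 < \<eta>" by simp_all
    obtain I F where F: "box_family I F" "(\<Union>i\<in>I. F i) \<subseteq> K" "vol K - \<eta> < (\<Sum>i\<in>I. vol (F i))"
      using box_family_inner_approx[OF K \<eta>] by blast
    obtain J G where G: "box_family J G" "(\<Union>i\<in>J. G i) \<subseteq> L" "vol L - \<eta> < (\<Sum>i\<in>J. vol (G i))"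
      using box_family_inner_approx[OF L \<eta>] by blast
    have ne: "I \<noteq> {}" "J \<noteq> {}" using F(3) G(3) pos by auto
    have "?f \<eta> \<le> (root ?n (\<Sum>i\<in>I. vol (F i)) + root ?n (\<Sum>i\<in>J. vol (G i))) ^ ?n"
      using pos F(3) G(3) by (intro power_mono add_mono real_root_le_mono add_nonneg_nonneg) simp_all
    also have "\<dots> \<le> vol ((\<Union>i\<in>I. F i) + (\<Union>i\<in>J. G i))"
      using brunn_minkowski_boxes[OF F(1) G(1) ne] by (simp only: brunn_minkowski_on_def)
    also have "\<dots> \<le> vol (K + L)"
      using F(2) G(2) K(1) L(1)
      by (intro vol_mono set_plus_mono2 compact_set_plus box_familyD(6) F(1) G(1) conv_bodies_compact)
    finally show ?case .
  qed
qed simp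

section \<open>Hukuhara solutions\<close>

text \<open>A maximizer in \<open>X\<close> has a nearest point in \<open>Y\<close>, and
  Cauchy-Schwarz compares the two. Only the one-sided excess enters, so exchanging \<open>X\<close>
  and \<open>Y\<close> gives the other inequality.\<close>

lemma support_fun_le_hausdorff:
  fixes X Y :: "'a::euclidean_space set"
  assumes X: "X \<in> conv_bodies" and Y: "Y \<in> conv_bodies"
    and d: "(SUP x\<in>X. infdist x Y) \<le> d"
  shows "support_fun X u \<le> support_fun Y u + d * norm u"
proof -
  obtain x where x: "x \<in> X" "support_fun X u = x \<bullet> u"
    using support_fun_attained[OF X] by metis
  have "compact ((\<lambda>x. infdist x Y) ` X)"
    using X by (intro compact_continuous_image continuous_intros) (simp add: conv_bodies_def)
  then have "bdd_above ((\<lambda>x. infdist x Y) ` X)"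
    by (intro bounded_imp_bdd_above compact_imp_bounded)
  then have "infdist x Y \<le> (SUP x\<in>X. infdist x Y)"
    using x(1) by (rule cSUP_upper[rotated])
  then have dx: "infdist x Y \<le> d" using d by simp
  have "closed Y" "Y \<noteq> {}" using Y by (simp_all add: conv_bodies_def compact_imp_closed)
  then obtain y where y: "y \<in> Y" "infdist x Y = dist x y"
    by (rule infdist_attains_inf)
  have "x \<bullet> u = y \<bullet> u + (x - y) \<bullet> u" by (simp add: inner_diff_left)
  also have "\<dots> \<le> support_fun Y u + norm (x - y) * norm u"
    using support_fun_upper[OF Y y(1)] by (intro add_mono norm_cauchy_schwarz)
  also have "norm (x - y) * norm u \<le> d * norm u"
    using dx y(2) by (intro mult_right_mono) (simp_all add: dist_norm)
  finally show ?thesis using x(2) by simp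
qed

lemma abs_support_fun_diff_le:
  fixes X Y :: "'a::euclidean_space set"
  assumes "X \<in> conv_bodies" "Y \<in> conv_bodies"
  shows "\<bar>support_fun X u - support_fun Y u\<bar> \<le> hausdorff_dist X Y * norm u"
  using support_fun_le_hausdorff[OF assms, of "hausdorff_dist X Y" u]
    support_fun_le_hausdorff[OF assms(2,1), of "hausdorff_dist X Y" u]
  by (simp add: hausdorff_dist_def abs_le_iff)

text \<open>Cancellation: support functions are additive and determine the body.\<close>

lemma hukuhara_diff_eq:
  assumes "is_hukuhara_diff X Y Z" "Y \<in> conv_bodies"
  shows "hukuhara_diff X Y = Z"
  unfolding hukuhara_diff_def
proof (rule the_equality)
  show "is_hukuhara_diff X Y Z" by (rule assms(1))
  fix Z' assume Z': "is_hukuhara_diff X Y Z'"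
  have Z: "Z \<in> conv_bodies" "Z' \<in> conv_bodies" "Y + Z' = Y + Z"
    using assms(1) Z' by (simp_all add: is_hukuhara_diff_def)
  show "Z' = Z"
  proof (rule support_fun_inject[OF Z(2,1)])
    fix u
    have "support_fun (Y + Z') u = support_fun (Y + Z) u" by (simp only: Z(3))
    then show "support_fun Z' u = support_fun Z u"
      using support_fun_plus[OF assms(2)] Z(1,2) by simp
  qed
qed

text \<open>The support function of a Hukuhara difference is the difference of the support
  functions, so set-valued quotients become scalar ones.\<close>

lemma support_fun_difference_quotient:
  fixes D :: "'a::euclidean_space set"
  assumes diff: "\<exists>Z. is_hukuhara_diff X Y Z" and Y: "Y \<in> conv_bodies" and D: "D \<in> conv_bodies" and "0 < h"
  shows "\<bar>(support_fun X u - support_fun Y u) / h - support_fun D u\<bar>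
    \<le> hausdorff_dist ((*\<^sub>R) (1 / h) ` hukuhara_diff X Y) D * norm u"
proof -
  obtain Z where Z: "is_hukuhara_diff X Y Z" using diff by blast
  have body: "Z \<in> conv_bodies" "X = Y + Z"
    using Z by (simp_all add: is_hukuhara_diff_def)
  have "(support_fun X u - support_fun Y u) / h = support_fun ((*\<^sub>R) (1 / h) ` Z) u"
    using body \<open>0 < h\<close> by (simp add: support_fun_plus[OF Y] support_fun_scaleR)
  then show ?thesis
    using abs_support_fun_diff_le[OF conv_bodies_scaleR[OF body(1)] D]
    by (simp only: hukuhara_diff_eq[OF Z Y])
qed

text \<open>\<open>F\<close> and \<open>G\<close> are left open to serve the forward and the
  backward quotient alike.\<close>

lemma tendsto_support_fun_quotient:
  fixes D :: "'a::euclidean_space set"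
  assumes ex: "\<forall>\<^sub>F h in at_right 0. \<exists>Z. is_hukuhara_diff (F h) (G h) Z"
    and lim: "((\<lambda>h. hausdorff_dist ((*\<^sub>R) (1 / h) ` hukuhara_diff (F h) (G h)) D) \<longlongrightarrow> 0) (at_right 0)"
    and G: "\<forall>\<^sub>F h in at_right 0. G h \<in> conv_bodies" and D: "D \<in> conv_bodies"
  shows "((\<lambda>h. (support_fun (F h) u - support_fun (G h) u) / h) \<longlongrightarrow> support_fun D u) (at_right 0)"
proof (rule Lim_null[THEN iffD2], rule Lim_null_comparison)
  let ?d = "\<lambda>h. hausdorff_dist ((*\<^sub>R) (1 / h) ` hukuhara_diff (F h) (G h)) D * norm u"
  show "(?d \<longlongrightarrow> 0) (at_right 0)"
    using tendsto_mult_left_zero[OF lim] .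
  show "\<forall>\<^sub>F h in at_right 0. norm ((support_fun (F h) u - support_fun (G h) u) / h - support_fun D u) \<le> ?d h"
    using ex G eventually_at_right_less[of 0]
  proof eventually_elim
    case (elim h)
    then show ?case
      using support_fun_difference_quotient[OF elim(1,2) D elim(3), of u] by simp
  qed
qed

lemma hukuhara_solution_support_fun:
  fixes A :: "'a::euclidean_space \<Rightarrow> 'a"
  assumes sol: "hukuhara_solution A X0 X"
  shows "0 < t \<Longrightarrow> ((\<lambda>s. support_fun (X s) u) has_real_derivative support_fun (A ` X t) u) (at t)"
    and "continuous_on {0..} (\<lambda>s. support_fun (X s) u)"
proof -
  let ?f = "\<lambda>s. support_fun (X s) u"
  have body: "X s \<in> conv_bodies" if "0 \<le> s" for s
    using sol that by (simp add: hukuhara_solution_def)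
  have der: "has_hukuhara_derivative X (A ` X s) s" if "0 \<le> s" for s
    using sol that by (simp add: hukuhara_solution_def)
  have D: "A ` X s \<in> conv_bodies" if "0 \<le> s" for s
    using der[OF that] by (simp add: has_hukuhara_derivative_def)
  have right: "((\<lambda>y. (?f y - ?f s) / (y - s)) \<longlongrightarrow> support_fun (A ` X s) u) (at_right s)" if s: "0 \<le> s" for s
  proof -
    have "((\<lambda>h. (?f (s + h) - ?f s) / h) \<longlongrightarrow> support_fun (A ` X s) u) (at_right 0)"
      using der[OF s] body[OF s] D[OF s]
      by (intro tendsto_support_fun_quotient) (simp_all add: has_hukuhara_derivative_def has_right_hukuhara_derivative_def)
    then show ?thesis
      unfolding filterlim_at_right_to_0[of _ _ s] by (simp add: add.commute[of s])
  qed
  have left: "((\<lambda>y. (?f y - ?f s) / (y - s)) \<longlongrightarrow> support_fun (A ` X s) u) (at_left s)" if s: "0 < s" for s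
  proof -
    have "\<forall>\<^sub>F h in at_right 0. h < s"
      using s by (intro eventually_at_rightI[of 0 s]) auto
    then have "\<forall>\<^sub>F h in at_right 0. X (s - h) \<in> conv_bodies"
      by eventually_elim (simp add: body)
    then have "((\<lambda>h. (?f s - ?f (s - h)) / h) \<longlongrightarrow> support_fun (A ` X s) u) (at_right 0)"
      using der[of s] D[of s] s
      by (intro tendsto_support_fun_quotient) (simp_all add: has_hukuhara_derivative_def has_left_hukuhara_derivative_def)
    \<comment> \<open>The second form arises when \<open>at_left s\<close> is reflected to
      \<open>at_right (- s)\<close> and then shifted to \<open>0\<close>.\<close>
    moreover have "(\<lambda>h. (?f s - ?f (s - h)) / h) = (\<lambda>h. (?f (- (h + - s)) - ?f s) / (- (h + - s) - s))"
    proof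
      fix h
      have "- (h + - s) = s - h" "- (h + - s) - s = - h" by simp_all
      then show "(?f s - ?f (s - h)) / h = (?f (- (h + - s)) - ?f s) / (- (h + - s) - s)"
        using minus_divide_divide[of "?f s - ?f (s - h)" h] by (simp only: minus_diff_eq)
    qed
    ultimately have "((\<lambda>h. (?f (- (h + - s)) - ?f s) / (- (h + - s) - s)) \<longlongrightarrow> support_fun (A ` X s) u) (at_right 0)"
      by (rule back_subst[where P = "\<lambda>g. (g \<longlongrightarrow> support_fun (A ` X s) u) (at_right 0)"])
    then show ?thesis
      unfolding filterlim_at_left_to_right[of _ _ s] filterlim_at_right_to_0[of _ _ "- s"] .
  qed
  show has_der: "(?f has_real_derivative support_fun (A ` X t) u) (at t)" if "0 < t" for t
    unfolding has_field_derivative_iff using that by (intro filterlim_split_at left right) simp_all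
  show "continuous_on {0..} ?f"
    unfolding continuous_on_eq_continuous_within
  proof
    fix s :: real assume "s \<in> {0..}"
    then consider "s = 0" | "0 < s" by force
    then show "continuous (at s within {0..}) ?f"
    proof cases
      case 1
      have "(?f has_real_derivative support_fun (A ` X 0) u) (at 0 within {0..})"
        unfolding has_field_derivative_iff at_within_Ici_at_right using right[of 0] by simp
      then show ?thesis
        unfolding 1 by (rule DERIV_continuous)
    next
      case 2
      then show ?thesis
        using DERIV_continuous[OF has_der[OF 2]] continuous_at_imp_continuous_at_within by blast
    qed
  qed
qed

section \<open>Taylor expansion of a solution\<close>

text \<open>The remainder of order \<open>Suc m\<close> of \<open>\<phi> k\<close> vanishes at
  \<open>0\<close>, and its derivative is the remainder of order \<open>m\<close> of
  \<open>\<phi> (Suc k)\<close>; hence the induction for all \<open>k\<close> at once. At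
  \<open>0\<close> continuity suffices for the mean value theorem.\<close>

lemma abs_taylor_remainder_le:
  fixes \<phi> :: "nat \<Rightarrow> real \<Rightarrow> real"
  assumes der: "\<And>k s. 0 < s \<Longrightarrow> (\<phi> k has_real_derivative \<phi> (Suc k) s) (at s)"
    and cont: "\<And>k. continuous_on {0..} (\<phi> k)"
    and bound: "\<And>k s. 0 \<le> s \<Longrightarrow> s \<le> T \<Longrightarrow> \<bar>\<phi> k s\<bar> \<le> C"
  shows "0 \<le> s \<Longrightarrow> s \<le> T \<Longrightarrow> \<bar>\<phi> k s - (\<Sum>j<m. s ^ j / fact j * \<phi> (k + j) 0)\<bar> \<le> C * (s ^ m / fact m)"
proof (induction m arbitrary: k s)
  case 0
  then show ?case using bound by simp
next
  case (Suc m)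
  show ?case
  proof (cases "s = 0")
    case True
    have "(\<Sum>j<Suc m. s ^ j / fact j * \<phi> (k + j) 0) = \<phi> k s"
      unfolding sum.lessThan_Suc_shift using True by simp
    with True show ?thesis by simp
  next
    case False
    then have s: "0 < s" using Suc.prems by simp
    define g where "g r = \<phi> k r - (\<phi> k 0 + (\<Sum>j<m. r ^ Suc j / fact (Suc j) * \<phi> (k + Suc j) 0))" for r
    define g' where "g' r = \<phi> (Suc k) r - (\<Sum>j<m. r ^ j / fact j * \<phi> (Suc k + j) 0)" for r
    define E where "E r = C * (r ^ Suc m / fact (Suc m))" for r :: real
    have pow: "((\<lambda>r. r ^ Suc j / fact (Suc j)) has_real_derivative r ^ j / fact j) (at r)" for j and r :: real
    proof -
      have "((\<lambda>r. r ^ Suc j / fact (Suc j)) has_real_derivative (real (Suc j) * r ^ j) / fact (Suc j)) (at r)"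
        by (rule DERIV_cdivide) (use DERIV_pow[of "Suc j" r] in simp)
      then show ?thesis by simp
    qed
    have der_g: "(g has_real_derivative g' r) (at r)" if "0 < r" for r
    proof -
      have "((\<lambda>r. \<phi> k r - (\<phi> k 0 + (\<Sum>j<m. r ^ Suc j / fact (Suc j) * \<phi> (k + Suc j) 0))) has_real_derivative
          \<phi> (Suc k) r - (0 + (\<Sum>j<m. r ^ j / fact j * \<phi> (k + Suc j) 0))) (at r)"
        by (intro DERIV_diff DERIV_add DERIV_const DERIV_sum DERIV_cmult_right der[OF that] pow)
      then show ?thesis
        unfolding g_def[abs_def] g'_def by (simp only: add_0 add_Suc add_Suc_right)
    qed
    have der_E: "(E has_real_derivative C * (r ^ m / fact m)) (at r)" for r
      unfolding E_def[abs_def] by (rule DERIV_cmult[OF pow])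
    have cont_g: "continuous_on {0..s} g"
      unfolding g_def[abs_def] by (intro continuous_intros continuous_on_subset[OF cont]) auto
    have cont_E: "continuous_on {0..s} E"
      unfolding E_def[abs_def] by (intro continuous_intros) auto
    have g'_le: "\<bar>g' r\<bar> \<le> C * (r ^ m / fact m)" if "0 < r" "r < s" for r
      unfolding g'_def using Suc.IH[of r "Suc k"] that Suc.prems by simp
    have zero: "g 0 = 0" "E 0 = 0" by (simp_all add: g_def E_def)
    \<comment> \<open>The signs \<open>1\<close> and \<open>- 1\<close> yield the two halves of the
      absolute value.\<close>
    have up: "0 \<le> E s - c * g s" if c: "c = 1 \<or> c = - 1" for c :: real
    proof -
      have cont_diff: "continuous_on {0..s} (\<lambda>r. E r - c * g r)"
        by (intro continuous_on_diff continuous_on_mult_left cont_g cont_E)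
      have "((\<lambda>r. E r - c * g r) has_derivative (*) (C * (x ^ m / fact m) - c * g' x)) (at x)"
        if "0 < x" "x < s" for x
        unfolding has_field_derivative_def[symmetric]
        by (intro DERIV_diff DERIV_cmult der_E der_g that)
      from mvt[OF s cont_diff this] obtain x where x: "0 < x" "x < s"
        and "(E s - c * g s) - (E 0 - c * g 0) = (C * (x ^ m / fact m) - c * g' x) * (s - 0)" .
      then have Es: "E s - c * g s = (C * (x ^ m / fact m) - c * g' x) * s"
        by (simp add: zero)
      have "0 \<le> C * (x ^ m / fact m) - c * g' x"
        using g'_le[OF x] c by auto
      then show ?thesis unfolding Es using s by simp
    qed
    have "\<phi> k s - (\<Sum>j<Suc m. s ^ j / fact j * \<phi> (k + j) 0) = g s"
      by (simp only: sum.lessThan_Suc_shift g_def) simp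
    then show ?thesis
      using up[of 1] up[of "-1"] unfolding E_def[symmetric] by (simp add: abs_le_iff)
  qed
qed

lemma orthogonal_transformation_funpow:
  fixes A :: "'a::euclidean_space \<Rightarrow> 'a"
  shows "orthogonal_transformation A \<Longrightarrow> orthogonal_transformation (A ^^ k)"
  by (induction k) (simp_all add: orthogonal_transformation_compose id_def)

lemma abs_support_fun_le:
  assumes "K \<in> conv_bodies" "\<And>x. x \<in> K \<Longrightarrow> norm x \<le> C"
  shows "\<bar>support_fun K u\<bar> \<le> C * norm u"
proof -
  obtain x where x: "x \<in> K" "support_fun K u = x \<bullet> u"
    using support_fun_attained[OF assms(1)] by metis
  have "\<bar>x \<bullet> u\<bar> \<le> norm x * norm u" by (rule Cauchy_Schwarz_ineq2)
  also have "\<dots> \<le> C * norm u" using assms(2)[OF x(1)] by (intro mult_right_mono) simp_all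
  finally show ?thesis using x(2) by simp
qed

text \<open>The support functions in the finitely many directions \<open>b\<close> and
  \<open>- b\<close> are continuous in time, hence bounded on a compact interval, and they control
  the l1-norm of every point.\<close>

lemma hukuhara_solution_bounded:
  fixes A :: "'a::euclidean_space \<Rightarrow> 'a"
  assumes sol: "hukuhara_solution A X0 X"
  shows "\<exists>C. \<forall>s\<in>{0..T}. \<forall>x\<in>X s. norm x \<le> C"
proof -
  have body: "X s \<in> conv_bodies" if "0 \<le> s" for s
    using sol that by (simp add: hukuhara_solution_def)
  have "\<exists>B. \<forall>s\<in>{0..T}. support_fun (X s) u \<le> B" for u
  proof -
    have "continuous_on {0..T} (\<lambda>s. support_fun (X s) u)"
      by (rule continuous_on_subset[OF hukuhara_solution_support_fun(2)[OF sol]]) simp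
    then have "bounded ((\<lambda>s. support_fun (X s) u) ` {0..T})"
      by (intro compact_imp_bounded compact_continuous_image) simp_all
    then obtain B where "\<forall>s\<in>{0..T}. \<bar>support_fun (X s) u\<bar> \<le> B"
      by (auto simp: bounded_iff)
    then show ?thesis by (meson abs_le_D1)
  qed
  then obtain B where B: "\<And>u s. s \<in> {0..T} \<Longrightarrow> support_fun (X s) u \<le> B u"
    by metis
  have "norm x \<le> (\<Sum>b\<in>Basis. max (B b) (B (- b)))" if s: "s \<in> {0..T}" and x: "x \<in> X s" for s x
  proof -
    have Xs: "X s \<in> conv_bodies" using s body by simp
    have le_B: "x \<bullet> b \<le> B b" "- (x \<bullet> b) \<le> B (- b)" for b
      using support_fun_upper[OF Xs x, of b] support_fun_upper[OF Xs x, of "- b"] B[OF s, of b] B[OF s, of "- b"]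
      by simp_all
    have "\<bar>x \<bullet> b\<bar> \<le> max (B b) (B (- b))" for b
      using le_B[of b] by linarith
    then have "(\<Sum>b\<in>Basis. \<bar>x \<bullet> b\<bar>) \<le> (\<Sum>b\<in>Basis. max (B b) (B (- b)))"
      by (intro sum_mono)
    with norm_le_l1[of x] show ?thesis by (rule order_trans)
  qed
  then show ?thesis by blast
qed

text \<open>\<open>m\<close> counts the terms, so the powers stay below \<open>m\<close>; estimates
  that rely on the summand \<open>X0\<close> use \<open>Suc m\<close>.\<close>

definition exp_partial :: "('a \<Rightarrow> 'a) \<Rightarrow> 'a::euclidean_space set \<Rightarrow> real \<Rightarrow> nat \<Rightarrow> 'a set" where
  "exp_partial A X0 t m = (\<Sum>j<m. (*\<^sub>R) (t ^ j / fact j) ` (A ^^ j) ` X0)"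

lemma exp_partial_body:
  assumes "orthogonal_transformation A" "X0 \<in> conv_bodies"
  shows "exp_partial A X0 t m \<in> conv_bodies"
  unfolding exp_partial_def using assms
  by (intro conv_bodies_sum conv_bodies_scaleR conv_bodies_linear_image orthogonal_transformation_linear
      orthogonal_transformation_funpow)

lemma support_fun_exp_partial:
  assumes A: "orthogonal_transformation A" and X0: "X0 \<in> conv_bodies" and t: "0 \<le> t"
  shows "support_fun (exp_partial A X0 t m) u = (\<Sum>j<m. t ^ j / fact j * support_fun ((A ^^ j) ` X0) u)"
proof -
  have body: "(A ^^ j) ` X0 \<in> conv_bodies" for j
    by (intro conv_bodies_linear_image orthogonal_transformation_linear orthogonal_transformation_funpow A X0)
  then show ?thesis
    using t by (simp add: exp_partial_def support_fun_sum support_fun_scaleR conv_bodies_scaleR)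
qed

text \<open>\<open>C\<close> bounds the norms of all points of \<open>X s\<close> for
  \<open>s\<close> up to \<open>t\<close>. Powers of \<open>A\<close> preserve norms, so it bounds
  every derivative in the tower and depends neither on \<open>m\<close> nor on
  \<open>u\<close>.\<close>

lemma hukuhara_solution_approx:
  fixes A :: "'a::euclidean_space \<Rightarrow> 'a"
  assumes A: "orthogonal_transformation A" and X0: "X0 \<in> conv_bodies"
    and sol: "hukuhara_solution A X0 X" and t: "0 \<le> t"
  shows "\<exists>C\<ge>0. \<forall>m u. \<bar>support_fun (X t) u - support_fun (exp_partial A X0 t m) u\<bar> \<le> C * (t ^ m / fact m) * norm u"
proof -
  obtain C where "\<forall>s\<in>{0..t}. \<forall>x\<in>X s. norm x \<le> C"
    using hukuhara_solution_bounded[OF sol, of t] by blast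
  then have C: "norm x \<le> C" if "0 \<le> s" "s \<le> t" "x \<in> X s" for s x
    using that by simp
  have body: "X s \<in> conv_bodies" if "0 \<le> s" for s
    using sol that by (simp add: hukuhara_solution_def)
  have X_0: "X 0 = X0" using sol by (simp add: hukuhara_solution_def)
  note Ak = orthogonal_transformation_funpow[OF A]
  note lin = orthogonal_transformation_linear[OF Ak]
  have "X t \<noteq> {}" using body[OF t] by (auto simp: conv_bodies_def)
  then obtain z where "z \<in> X t" by blast
  then have "0 \<le> C" using C[OF t order_refl] norm_ge_zero[of z] by (meson order_trans)
  moreover have "\<bar>support_fun (X t) u - support_fun (exp_partial A X0 t m) u\<bar> \<le> C * (t ^ m / fact m) * norm u" for m u
  proof -
    define \<phi> where "\<phi> k s = support_fun ((A ^^ k) ` X s) u" for k s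
    have \<phi>: "\<phi> k s = support_fun (X s) (adjoint (A ^^ k) u)" if "0 \<le> s" for k s
      unfolding \<phi>_def by (rule support_fun_linear_image[OF lin body[OF that]])
    have "\<bar>\<phi> 0 t - (\<Sum>j<m. t ^ j / fact j * \<phi> (0 + j) 0)\<bar> \<le> C * norm u * (t ^ m / fact m)"
    proof (rule abs_taylor_remainder_le[where T = t])
      fix k and s :: real assume s: "0 < s"
      have AX: "A ` X s \<in> conv_bodies"
        using s by (intro conv_bodies_linear_image body orthogonal_transformation_linear A) simp
      have "((\<lambda>s. support_fun (X s) (adjoint (A ^^ k) u)) has_real_derivative support_fun (A ` X s) (adjoint (A ^^ k) u)) (at s)"
        by (rule hukuhara_solution_support_fun(1)[OF sol s])
      moreover have "support_fun (A ` X s) (adjoint (A ^^ k) u) = \<phi> (Suc k) s"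
        unfolding support_fun_linear_image[OF lin AX, symmetric] \<phi>_def
        by (simp only: funpow_Suc_right image_comp)
      \<comment> \<open>The adjoint formula for \<phi> holds at nonnegative times; around
        \<open>s > 0\<close> these form a neighbourhood.\<close>
      moreover have "\<forall>\<^sub>F r in nhds s. 0 < r"
        using eventually_nhds_in_open[of "{0<..}" s] s by simp
      then have "\<forall>\<^sub>F r in nhds s. support_fun (X r) (adjoint (A ^^ k) u) = \<phi> k r"
        by eventually_elim (simp add: \<phi>)
      ultimately show "(\<phi> k has_real_derivative \<phi> (Suc k) s) (at s)"
        using DERIV_cong_ev[OF refl, of "\<lambda>s. support_fun (X s) (adjoint (A ^^ k) u)" "\<phi> k" s
            "support_fun (A ` X s) (adjoint (A ^^ k) u)" "\<phi> (Suc k) s"] by simp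
    next
      fix k
      show "continuous_on {0..} (\<phi> k)"
        using hukuhara_solution_support_fun(2)[OF sol, of "adjoint (A ^^ k) u"]
        by (rule continuous_on_eq) (simp add: \<phi>)
    next
      fix k and s :: real assume s: "0 \<le> s" "s \<le> t"
      show "\<bar>\<phi> k s\<bar> \<le> C * norm u"
        unfolding \<phi>_def
      proof (rule abs_support_fun_le)
        show "(A ^^ k) ` X s \<in> conv_bodies" by (rule conv_bodies_linear_image[OF lin body[OF s(1)]])
        show "norm x \<le> C" if "x \<in> (A ^^ k) ` X s" for x
          using that C[OF s] orthogonal_transformation_norm[OF Ak] by auto
      qed
    qed (use t in simp_all)
    then show ?thesis
      unfolding support_fun_exp_partial[OF A X0 t]
      by (simp add: \<phi>_def X_0 mult_ac)
  qed
  ultimately show ?thesis by blast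
qed

section \<open>Volume bounds\<close>

text \<open>The \<open>n\<close>-th root of the volume of the \<open>j\<close>-th term is
  \<open>c j\<close> times that of \<open>v\<close>, and these roots add up.\<close>

lemma brunn_minkowski_sum:
  fixes K :: "nat \<Rightarrow> 'a::euclidean_space set"
  assumes K: "\<And>j. K j \<in> conv_bodies" "\<And>j. vol (K j) = v" and v: "0 < v" and c: "\<And>j. 0 < c j"
  shows "(\<Sum>j<Suc m. c j) ^ DIM('a) * v \<le> vol (\<Sum>j<Suc m. (*\<^sub>R) (c j) ` K j)"
proof (induction m)
  case 0
  then show ?case using c[of 0] by (simp add: vol_scaleR K)
next
  case (Suc m)
  let ?n = "DIM('a)" and ?S = "\<Sum>j<Suc m. (*\<^sub>R) (c j) ` K j" and ?s = "\<Sum>j<Suc m. c j"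
  let ?L = "(*\<^sub>R) (c (Suc m)) ` K (Suc m)"
  have s: "0 < ?s" using c by (intro sum_pos) auto
  have body: "?S \<in> conv_bodies" "?L \<in> conv_bodies"
    using K(1) by (intro conv_bodies_sum conv_bodies_scaleR; simp)+
  have volL: "vol ?L = c (Suc m) ^ ?n * v"
    using c[of "Suc m"] by (simp add: vol_scaleR K)
  have "0 < ?s ^ ?n * v" using s v by simp
  \<comment> \<open>The volume bound of the induction hypothesis also provides the interior points
    that Brunn-Minkowski demands.\<close>
  then have "0 < vol ?S" using Suc.IH by linarith
  moreover have "0 < vol ?L" using volL c[of "Suc m"] v by simp
  ultimately have int: "interior ?S \<noteq> {}" "interior ?L \<noteq> {}"
    using body by (simp_all add: vol_pos_imp_interior conv_bodies_def del: sum.lessThan_Suc)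
  have root: "root ?n (a ^ ?n * v) = a * root ?n v" if "0 < a" for a
    using that by (simp add: real_root_mult real_root_power_cancel)
  have "(\<Sum>j<Suc (Suc m). c j) ^ ?n * v = (?s * root ?n v + c (Suc m) * root ?n v) ^ ?n"
    using v by (simp add: distrib_right[symmetric] power_mult_distrib)
  also have "\<dots> = (root ?n (?s ^ ?n * v) + root ?n (vol ?L)) ^ ?n"
    by (simp only: volL root[OF s] root[OF c])
  also have "\<dots> \<le> (root ?n (vol ?S) + root ?n (vol ?L)) ^ ?n"
    using Suc.IH s v by (intro power_mono add_mono add_nonneg_nonneg real_root_le_mono) simp_all
  also have "\<dots> \<le> vol (?S + ?L)"
    by (rule brunn_minkowski[OF body(1) int(1) body(2) int(2)])
  finally show ?case by simp
qed

section \<open>Volumes of the iterates and of the partial sums\<close>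

context
  fixes A :: "real ^ 'n \<Rightarrow> real ^ 'n" and X0 :: "(real ^ 'n) set"
  assumes A: "orthogonal_transformation A" and X0: "X0 \<in> conv_bodies" "interior X0 \<noteq> {}"
begin

lemma linear_funpow: "linear (A ^^ k)"
  by (rule orthogonal_transformation_linear[OF orthogonal_transformation_funpow[OF A]])

lemma iterate_body: "(A ^^ k) ` X0 \<in> conv_bodies"
  by (rule conv_bodies_linear_image[OF linear_funpow X0(1)])

lemma vol_iterate: "vol ((A ^^ k) ` X0) = vol X0"
  by (intro vol_orthogonal_image orthogonal_transformation_funpow A conv_bodies_compact X0)

lemma interior_iterate: "interior ((A ^^ k) ` X0) \<noteq> {}"
  using vol_iterate[of k] vol_pos[OF X0] iterate_body[of k]
  by (intro vol_pos_imp_interior) (simp_all add: conv_bodies_def)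

text \<open>Reading the last entry \<open>X0\<close> as the iterate with exponent \<open>0\<close>
  puts all entries into one form.\<close>

lemma M_bound_nth:
  assumes "length ks = CARD('n) - 1" "l < CARD('n)"
  shows "(map (\<lambda>k. (A ^^ k) ` X0) ks @ [X0]) ! l = (A ^^ (if l < CARD('n) - 1 then ks ! l else 0)) ` X0"
  using assms by (auto simp: nth_append)

lemma mixed_volume_M_bound:
  assumes "length ks = CARD('n) - 1"
  shows "mixed_volume (map (\<lambda>k. (A ^^ k) ` X0) ks @ [X0]) =
    polarization CARD('n) (\<lambda>J. vol (\<Sum>l\<in>J. (A ^^ (if l < CARD('n) - 1 then ks ! l else 0)) ` X0))"
proof -
  let ?Ks = "map (\<lambda>k. (A ^^ k) ` X0) ks @ [X0]"
  have "mixed_volume ?Ks = polarization CARD('n) (\<lambda>J. vol (\<Sum>l\<in>J. ?Ks ! l))"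
    by (rule mixed_volume_bodies)
      (simp only: M_bound_nth[OF assms] iterate_body interior_iterate simp_thms not_False_eq_True)
  also have "\<dots> = polarization CARD('n) (\<lambda>J. vol (\<Sum>l\<in>J. (A ^^ (if l < CARD('n) - 1 then ks ! l else 0)) ` X0))"
  proof (intro polarization_cong arg_cong[where f=vol] sum.cong refl)
    fix J l assume "J \<subseteq> {..<CARD('n)}" "l \<in> J"
    then have "l < CARD('n)" by auto
    then show "?Ks ! l = (A ^^ (if l < CARD('n) - 1 then ks ! l else 0)) ` X0"
      by (rule M_bound_nth[OF assms])
  qed
  finally show ?thesis .
qed

text \<open>Boundedness ensures that the real supremum \<open>M_bound\<close> dominates its members.
  As \<open>A\<close> is an isometry, all sums of at most \<open>n\<close> iterates stay in one
  ball, and polarization has finitely many terms.\<close>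

lemma bdd_above_mixed_volumes:
  "bdd_above ((\<lambda>ks. mixed_volume (map (\<lambda>k. (A ^^ k) ` X0) ks @ [X0])) ` {ks. length ks = CARD('n) - 1})"
proof -
  obtain R where R: "\<And>x. x \<in> X0 \<Longrightarrow> norm x \<le> R"
    using compact_imp_bounded[OF conv_bodies_compact[OF X0(1)]] unfolding bounded_iff by blast
  have "X0 \<noteq> {}" using X0 by auto
  then have R0: "0 \<le> R" using R norm_ge_zero by (meson all_not_in_conv order_trans)
  let ?B = "vol (cball (0 :: real ^ 'n) (real CARD('n) * R))"
  have B: "vol (\<Sum>l\<in>J. (A ^^ k l) ` X0) \<le> ?B" if J: "J \<subseteq> {..<CARD('n)}" for J and k :: "nat \<Rightarrow> nat"
  proof (rule vol_mono)
    have fin: "finite J" using J finite_subset by blast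
    show "(\<Sum>l\<in>J. (A ^^ k l) ` X0) \<subseteq> cball 0 (real CARD('n) * R)"
    proof
      fix y assume "y \<in> (\<Sum>l\<in>J. (A ^^ k l) ` X0)"
      then obtain s where s: "y = sum s J" "\<And>l. l \<in> J \<Longrightarrow> s l \<in> (A ^^ k l) ` X0"
        unfolding set_sum_alt[OF fin] by blast
      have "norm (s l) \<le> R" if "l \<in> J" for l
        using s(2)[OF that] R orthogonal_transformation_norm[OF orthogonal_transformation_funpow[OF A]] by auto
      then have "norm y \<le> (\<Sum>l\<in>J. R)"
        unfolding s(1) by (rule sum_norm_le)
      also have "\<dots> \<le> real CARD('n) * R"
        using card_mono[OF _ J] R0 by (simp add: mult_right_mono)
      finally show "y \<in> cball 0 (real CARD('n) * R)" by simp
    qed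
    show "compact (\<Sum>l\<in>J. (A ^^ k l) ` X0)"
      by (intro conv_bodies_compact conv_bodies_sum iterate_body)
  qed (rule compact_cball)
  show ?thesis
  proof (rule bdd_aboveI2)
    fix ks :: "nat list" assume "ks \<in> {ks. length ks = CARD('n) - 1}"
    then have len: "length ks = CARD('n) - 1" by simp
    let ?F = "\<lambda>J. vol (\<Sum>l\<in>J. (A ^^ (if l < CARD('n) - 1 then ks ! l else 0)) ` X0)"
    have "(\<Sum>J\<in>Pow {..<CARD('n)}. (-1) ^ (CARD('n) - card J) * ?F J) \<le> (\<Sum>J\<in>Pow {..<CARD('n)}. ?B)"
    proof (rule sum_mono)
      fix J assume "J \<in> Pow {..<CARD('n)}"
      then have J: "J \<subseteq> {..<CARD('n)}" by simp
      have "(-1) ^ (CARD('n) - card J) * ?F J \<le> \<bar>(-1) ^ (CARD('n) - card J) * ?F J\<bar>" by (rule abs_ge_self)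
      also have "\<dots> = ?F J" by (simp add: abs_mult power_abs)
      also have "\<dots> \<le> ?B" by (rule B[OF J])
      finally show "(-1) ^ (CARD('n) - card J) * ?F J \<le> ?B" .
    qed
    then show "mixed_volume (map (\<lambda>k. (A ^^ k) ` X0) ks @ [X0]) \<le> (\<Sum>J\<in>Pow {..<CARD('n)}. ?B) / fact CARD('n)"
      unfolding mixed_volume_M_bound[OF len] polarization_def
      by (rule divide_right_mono) simp
  qed
qed

lemma polarization_le_M_bound:
  "polarization CARD('n) (\<lambda>J. vol (\<Sum>l\<in>J. (A ^^ i l) ` X0)) \<le> M_bound A X0"
proof -
  let ?n = "CARD('n)"
  have n: "0 < ?n" by simp
  have "\<exists>l0<?n. \<forall>l<?n. i l0 \<le> i l"
    using ex_has_least_nat[of "\<lambda>l. l < ?n" 0 i] n by blast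
  then obtain l0 where l0: "l0 < ?n" "\<And>l. l < ?n \<Longrightarrow> i l0 \<le> i l" by blast
  \<comment> \<open>The smallest exponent need not stand in the last slot, where
    \<open>M_bound\<close> has \<open>X0\<close>; the transposition moves it there.\<close>
  define p where "p = Transposition.transpose l0 (?n - 1)"
  have p: "p permutes {..<?n}"
    unfolding p_def using l0(1) n by (intro permutes_swap_id) simp_all
  define ks where "ks = map (\<lambda>l. i (p l) - i l0) [0..<?n - 1]"
  have len: "length ks = ?n - 1" by (simp add: ks_def)
  \<comment> \<open>In the last slot \<open>p l = l0\<close>, so the difference is the default
    \<open>0\<close>.\<close>
  have k: "(if l < ?n - 1 then ks ! l else 0) = i (p l) - i l0" if "l < ?n" for l
    using that by (cases "l = ?n - 1") (auto simp: ks_def p_def)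
  have "vol (\<Sum>l\<in>J. (A ^^ i l) ` X0) = vol (\<Sum>l\<in>J. (A ^^ (i l - i l0)) ` X0)" if J: "J \<subseteq> {..<?n}" for J
  proof -
    have "(\<Sum>l\<in>J. (A ^^ i l) ` X0) = (\<Sum>l\<in>J. (A ^^ i l0) ` (A ^^ (i l - i l0)) ` X0)"
    proof (rule sum.cong[OF refl])
      fix l assume "l \<in> J"
      then have "i l = i l0 + (i l - i l0)" using J l0(2)[of l] by auto
      then have "A ^^ i l = A ^^ i l0 \<circ> A ^^ (i l - i l0)" by (metis funpow_add)
      then show "(A ^^ i l) ` X0 = (A ^^ i l0) ` (A ^^ (i l - i l0)) ` X0"
        by (simp only: image_comp)
    qed
    also have "\<dots> = (A ^^ i l0) ` (\<Sum>l\<in>J. (A ^^ (i l - i l0)) ` X0)"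
      by (rule linear_image_set_sum[OF linear_funpow, symmetric])
    finally show ?thesis
      by (simp only: vol_orthogonal_image[OF orthogonal_transformation_funpow[OF A] conv_bodies_compact[OF conv_bodies_sum[OF iterate_body]]])
  qed
  then have "polarization ?n (\<lambda>J. vol (\<Sum>l\<in>J. (A ^^ i l) ` X0)) =
      polarization ?n (\<lambda>J. vol (\<Sum>l\<in>J. (A ^^ (i l - i l0)) ` X0))"
    by (rule polarization_cong)
  also have "\<dots> = polarization ?n (\<lambda>J. vol (\<Sum>l\<in>p ` J. (A ^^ (i l - i l0)) ` X0))"
    by (rule polarization_permute[OF p, symmetric])
  also have "\<dots> = polarization ?n (\<lambda>J. vol (\<Sum>l\<in>J. (A ^^ (if l < ?n - 1 then ks ! l else 0)) ` X0))"
  proof (rule polarization_cong)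
    fix J assume J: "J \<subseteq> {..<?n}"
    have "(\<Sum>l\<in>p ` J. (A ^^ (i l - i l0)) ` X0) = (\<Sum>l\<in>J. (A ^^ (i (p l) - i l0)) ` X0)"
      using permutes_inj[OF p] by (simp add: sum.reindex inj_on_subset)
    also have "\<dots> = (\<Sum>l\<in>J. (A ^^ (if l < ?n - 1 then ks ! l else 0)) ` X0)"
      using J by (intro sum.cong refl) (subst k, auto)
    finally show "vol (\<Sum>l\<in>p ` J. (A ^^ (i l - i l0)) ` X0) =
        vol (\<Sum>l\<in>J. (A ^^ (if l < ?n - 1 then ks ! l else 0)) ` X0)" by (rule arg_cong)
  qed
  also have "\<dots> = mixed_volume (map (\<lambda>k. (A ^^ k) ` X0) ks @ [X0])"
    by (rule mixed_volume_M_bound[OF len, symmetric])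
  also have "\<dots> \<le> M_bound A X0"
    unfolding M_bound_def using len by (intro cSUP_upper bdd_above_mixed_volumes) simp
  finally show ?thesis .
qed

text \<open>The monomials over all tuples add up to the \<open>n\<close>-th power of the truncated
  exponential series.\<close>

lemma vol_exp_partial_le:
  assumes t: "0 \<le> t"
  shows "vol (exp_partial A X0 t m) \<le> M_bound A X0 * (\<Sum>j<m. t ^ j / fact j) ^ CARD('n)"
proof -
  let ?n = "CARD('n)" and ?x = "\<lambda>j. t ^ j / fact j"
  have "vol (exp_partial A X0 t m) = (\<Sum>i\<in>{..<?n} \<rightarrow>\<^sub>E {..<m}.
      polarization ?n (\<lambda>J. vol (\<Sum>l\<in>J. (A ^^ i l) ` X0)) * (\<Prod>l<?n. ?x (i l)))"
    unfolding exp_partial_def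
    by (rule minkowski_expansion) (simp_all add: iterate_body interior_iterate t)
  also have "\<dots> \<le> (\<Sum>i\<in>{..<?n} \<rightarrow>\<^sub>E {..<m}. M_bound A X0 * (\<Prod>l<?n. ?x (i l)))"
    using t by (intro sum_mono mult_right_mono polarization_le_M_bound prod_nonneg) simp
  also have "\<dots> = M_bound A X0 * (\<Prod>l<?n. \<Sum>j<m. ?x j)"
    by (simp add: sum_distrib_left[symmetric] prod_sum_PiE del: prod_constant)
  finally show ?thesis by simp
qed

text \<open>At \<open>t = 0\<close> the coefficients with \<open>j > 0\<close> vanish, whereas the
  iterated Brunn-Minkowski inequality asks for positive ones.\<close>

lemma vol_exp_partial_ge:
  assumes t: "0 < t"
  shows "vol X0 * (\<Sum>j<Suc m. t ^ j / fact j) ^ CARD('n) \<le> vol (exp_partial A X0 t (Suc m))"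
  using brunn_minkowski_sum[of "\<lambda>j. (A ^^ j) ` X0" "vol X0" "\<lambda>j. t ^ j / fact j" m] t
    iterate_body vol_iterate vol_pos[OF X0]
  unfolding exp_partial_def by (simp add: mult.commute del: sum.lessThan_Suc)

text \<open>The summand \<open>X0\<close> contains the ball, and adding one point of the remaining
  sum only translates it; so the centre may depend on \<open>m\<close> but the radius does
  not.\<close>

lemma exp_partial_inball:
  assumes t: "0 \<le> t" and ball: "cball p r \<subseteq> X0" "0 \<le> r"
  shows "\<exists>q. \<forall>u. q \<bullet> u + r * norm u \<le> support_fun (exp_partial A X0 t (Suc m)) u"
proof -
  let ?R = "\<Sum>j<m. (*\<^sub>R) (t ^ Suc j / fact (Suc j)) ` (A ^^ Suc j) ` X0"
  have R: "?R \<in> conv_bodies"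
    by (intro conv_bodies_sum conv_bodies_scaleR iterate_body)
  then obtain z where z: "z \<in> ?R" by (auto simp: conv_bodies_def)
  have eq: "exp_partial A X0 t (Suc m) = X0 + ?R"
    unfolding exp_partial_def sum.lessThan_Suc_shift by simp
  have "(p + z) \<bullet> u + r * norm u \<le> support_fun (exp_partial A X0 t (Suc m)) u" for u
    unfolding eq support_fun_plus[OF X0(1) R]
    using support_fun_ge_cball[OF X0(1) ball, of u] support_fun_upper[OF R z, of u]
    by (simp add: inner_add_left)
  then show ?thesis by blast
qed

end

theorem lemma3p2:
  fixes A :: "real ^ 'n \<Rightarrow> real ^ 'n"
    and X0 :: "(real ^ 'n) set"
    and X :: "real \<Rightarrow> (real ^ 'n) set"
  assumes "orthogonal_transformation A"
    and "X0 \<in> conv_bodies"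
    and "interior X0 \<noteq> {}"
    and "hukuhara_solution A X0 X"
  shows "\<forall>t\<ge>0. vol X0 * exp (real CARD('n) * t) \<le> vol (X t) \<and>
               vol (X t) \<le> M_bound A X0 * exp (real CARD('n) * t)"
proof (intro allI impI)
  fix t :: real assume t: "0 \<le> t"
  let ?n = "CARD('n)"
  note A = assms(1) and X0 = assms(2,3) and sol = assms(4)
  have Xt: "X t \<in> conv_bodies"
    using sol t by (simp add: hukuhara_solution_def)
  obtain p where "p \<in> interior X0" using X0(2) by blast
  then obtain r where r: "0 < r" "cball p r \<subseteq> X0"
    by (meson mem_interior_cball)
  obtain C where C: "0 \<le> C" and approx: "\<And>m u. \<bar>support_fun (X t) u - support_fun (exp_partial A X0 t m) u\<bar>
      \<le> C * (t ^ m / fact m) * norm u"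
    using hukuhara_solution_approx[OF A X0(1) sol t] by blast
  \<comment> \<open>\<open>S m\<close> has \<open>Suc m\<close> terms, so its error is of order
    \<open>Suc m\<close>.\<close>
  define e where "e m = C * (t ^ Suc m / fact (Suc m))" for m
  define S where "S m = exp_partial A X0 t (Suc m)" for m
  define s where "s m = (\<Sum>j<Suc m. t ^ j / fact j)" for m
  have exp_sums: "(\<lambda>m. t ^ m / fact m) sums exp t"
    using exp_converges[of t] by (simp add: divide_inverse_commute)
  then have s: "s \<longlonglongrightarrow> exp t"
    unfolding s_def[abs_def] sums_def by (rule LIMSEQ_Suc)
  have "(\<lambda>m. t ^ m / fact m) \<longlonglongrightarrow> 0"
    by (rule summable_LIMSEQ_zero[OF sums_summable[OF exp_sums]])
  from tendsto_mult_right_zero[OF LIMSEQ_Suc[OF this], of C] have e: "e \<longlonglongrightarrow> 0"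
    unfolding e_def[abs_def] .
  have e_nonneg: "0 \<le> e m" for m
    using C t by (simp add: e_def)
  have S: "S m \<in> conv_bodies" for m
    unfolding S_def by (rule exp_partial_body[OF A X0(1)])
  have close: "support_fun (X t) u \<le> support_fun (S m) u + e m * norm u"
    "support_fun (S m) u \<le> support_fun (X t) u + e m * norm u" for m u
    using approx[of u "Suc m"] unfolding S_def e_def by linarith+
  have "\<exists>q. \<forall>u. q \<bullet> u + r * norm u \<le> support_fun (S m) u" for m
    unfolding S_def using r by (intro exp_partial_inball[OF A X0 t]) simp_all
  then obtain q where q: "\<And>m u. q m \<bullet> u + r * norm u \<le> support_fun (S m) u" by metis
  have exp_n: "exp t ^ ?n = exp (real ?n * t)"
    by (rule exp_of_nat_mult[symmetric])
  have upper: "vol (X t) \<le> M_bound A X0 * exp (real ?n * t)"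
  proof (rule tendsto_lowerbound)
    have "(\<lambda>m. (1 + e m / r) ^ ?n * (M_bound A X0 * s m ^ ?n)) \<longlonglongrightarrow> (1 + 0 / r) ^ ?n * (M_bound A X0 * exp t ^ ?n)"
      using r by (intro tendsto_intros e s) simp
    then show "(\<lambda>m. (1 + e m / r) ^ ?n * (M_bound A X0 * s m ^ ?n)) \<longlonglongrightarrow> M_bound A X0 * exp (real ?n * t)"
      by (simp add: exp_n)
    have "vol (X t) \<le> (1 + e m / r) ^ ?n * (M_bound A X0 * s m ^ ?n)" for m
    proof -
      have "vol (X t) \<le> (1 + e m / r) ^ ?n * vol (S m)"
        using vol_le_if_support_fun_le[OF Xt S q r(1) e_nonneg close(1)] by simp
      also have "\<dots> \<le> (1 + e m / r) ^ ?n * (M_bound A X0 * s m ^ ?n)"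
        unfolding S_def s_def using r(1) e_nonneg[of m]
        by (intro mult_left_mono vol_exp_partial_le[OF A X0 t] zero_le_power) simp
      finally show ?thesis .
    qed
    then show "\<forall>\<^sub>F m in sequentially. vol (X t) \<le> (1 + e m / r) ^ ?n * (M_bound A X0 * s m ^ ?n)"
      by simp
  qed simp
  have lower: "vol X0 * exp (real ?n * t) \<le> vol (X t)"
  \<comment> \<open>\<open>vol_exp_partial_ge\<close> requires positive \<open>t\<close>; at
    \<open>t = 0\<close> both sides equal \<open>vol X0\<close>.\<close>
  proof (cases "t = 0")
    case True
    then show ?thesis using sol by (simp add: hukuhara_solution_def)
  next
    case False
    then have t_pos: "0 < t" using t by simp
    show ?thesis
    proof (rule tendsto_le)
      have "(\<lambda>m. vol X0 * s m ^ ?n) \<longlonglongrightarrow> vol X0 * exp t ^ ?n"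
        by (intro tendsto_intros s)
      then show "(\<lambda>m. vol X0 * s m ^ ?n) \<longlonglongrightarrow> vol X0 * exp (real ?n * t)"
        by (simp only: exp_n)
      have "(\<lambda>m. (1 + e m / (r - e m)) ^ ?n * vol (X t)) \<longlonglongrightarrow> (1 + 0 / (r - 0)) ^ ?n * vol (X t)"
        using r by (intro tendsto_intros e) simp
      then show "(\<lambda>m. (1 + e m / (r - e m)) ^ ?n * vol (X t)) \<longlonglongrightarrow> vol (X t)" by simp
      have "\<forall>\<^sub>F m in sequentially. e m < r"
        using order_tendstoD(2)[OF e r(1)] .
      then show "\<forall>\<^sub>F m in sequentially. vol X0 * s m ^ ?n \<le> (1 + e m / (r - e m)) ^ ?n * vol (X t)"
      proof eventually_elim
        case (elim m)
        \<comment> \<open>The ball is known to lie in \<open>S m\<close>; the error shrinks it to a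
          ball of radius \<open>r - e m\<close> in \<open>X t\<close>.\<close>
        have "q m \<bullet> u + (r - e m) * norm u \<le> support_fun (X t) u" for u
          using q[of m u] close(2)[of m u] by (simp add: left_diff_distrib)
        from vol_le_if_support_fun_le[OF S Xt this _ e_nonneg close(2)] elim
        have "vol (S m) \<le> (1 + e m / (r - e m)) ^ ?n * vol (X t)" by simp
        with vol_exp_partial_ge[OF A X0 t_pos, of m] show ?case
          unfolding S_def s_def by linarith
      qed
    qed simp
  qed
  from lower upper show "vol X0 * exp (real ?n * t) \<le> vol (X t) \<and> vol (X t) \<le> M_bound A X0 * exp (real ?n * t)" ..
qed

end
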